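(* Let $T$ be a Hopf algebra with bijective antipode $S$, $A$ a braided-commutative left-right Yetter-Drinfeld $T$-module algebra, $A\sharp T$ the smash product algebra, and $\tau\colon A\sharp T\to A\sharp T$ the map $\tau(a\sharp t)=S(t)\,S^2(a_{[1]})\cdot a_{[0]}$. Let $\sum_{\rho}K^{\rho}\otimes L^{\rho}\in\{x\otimes1,\ Sx_{[1]}\otimes x_{[0]}\mid x\in A\}\cup\{f_{(1)}\otimes f_{(2)}\mid f\in T\}\subset (A\sharp T)\otimes_{\bm k}(A\sharp T)$ be a distinguished generator. Then for any $a\in A$, $$\sum_{\rho}K^{\rho}\cdot(a\sharp1)\cdot\tau(L^{\rho})\in A\sharp1.$$
   Context: Let $\bm k$ be a field, $\otimes=\otimes_{\bm k}$, Sweedler notation $\Delta_T(t)=t_{(1)}\otimes t_{(2)}$. $T$ is a Hopf $\bm k$-algebra with coproduct $\Delta_T$, counit $\epsilon_T$ and bijective antipode $S$. A braided-commutative left-right Yetter-Drinfeld $T$-module algebra $A$ is a unital associative algebra with a left $T$-action $\blacktriangleright$ satisfying $t\blacktriangleright(ab)=(t_{(1)}\blacktriangleright a)(t_{(2)}\blacktriangleright b)$, $t\blacktriangleright1=\epsilon_T(t)1$, and a right $T$-coaction $a\mapsto a_{[0]}\otimes a_{[1]}$ which is an algebra morphism $A\to A\otimes T^{\mathrm{op}}$, such that $(t_{(1)}\blacktriangleright a_{[0]})\otimes t_{(2)}a_{[1]}=(t_{(2)}\blacktriangleright a)_{[0]}\otimes(t_{(2)}\blacktriangleright a)_{[1]}t_{(1)}$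 and $x_{[0]}(x_{[1]}\blacktriangleright a)=ax$ for all $t\in T$, $a,x\in A$. $A\sharp T$ is $A\otimes T$ with product $(a\sharp t)(a'\sharp t')=a(t_{(1)}\blacktriangleright a')\sharp t_{(2)}t'$ and unit $1\sharp1$. The dot $\cdot$ is multiplication in $A\sharp T$; $A\cong A\sharp1$ and $T\cong1\sharp T$ are viewed as subalgebras, and $T\otimes T\subset (A\sharp T)\otimes(A\sharp T)$. "Distinguished generators" are exactly the elements of the displayed set. *)

theory Defs
  imports "HOL-Algebra.Module" "HOL-Algebra.AbelCoset"
begin

section \<open>Linear maps and associative algebras\<close>

text \<open>The locale \<^locale>\<open>algebra\<close> of the library is restricted to commutative algebras.\<close>

locale assoc_algebra = module R M + M?: ring M for R (structure) and M (structure) +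
  assumes smult_mult_left:
      "\<lbrakk>c \<in> carrier R; x \<in> carrier M; y \<in> carrier M\<rbrakk>
        \<Longrightarrow> (c \<odot>\<^bsub>M\<^esub> x) \<otimes>\<^bsub>M\<^esub> y = c \<odot>\<^bsub>M\<^esub> (x \<otimes>\<^bsub>M\<^esub> y)"
    and smult_mult_right:
      "\<lbrakk>c \<in> carrier R; x \<in> carrier M; y \<in> carrier M\<rbrakk>
        \<Longrightarrow> x \<otimes>\<^bsub>M\<^esub> (c \<odot>\<^bsub>M\<^esub> y) = c \<odot>\<^bsub>M\<^esub> (x \<otimes>\<^bsub>M\<^esub> y)"

definition linear_maps ::
  "('k, 'c) ring_scheme \<Rightarrow> ('k, 'm, 'd) module_scheme \<Rightarrow> ('k, 'n, 'e) module_scheme \<Rightarrow> ('m \<Rightarrow> 'n) set"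
  where "linear_maps R M N =
    {f. f \<in> carrier M \<rightarrow> carrier N \<and>
        (\<forall>x\<in>carrier M. \<forall>y\<in>carrier M. f (x \<oplus>\<^bsub>M\<^esub> y) = f x \<oplus>\<^bsub>N\<^esub> f y) \<and>
        (\<forall>c\<in>carrier R. \<forall>x\<in>carrier M. f (c \<odot>\<^bsub>M\<^esub> x) = c \<odot>\<^bsub>N\<^esub> f x)}"

definition algebra_homs ::
  "('k, 'c) ring_scheme \<Rightarrow> ('k, 'm, 'd) module_scheme \<Rightarrow> ('k, 'n, 'e) module_scheme \<Rightarrow> ('m \<Rightarrow> 'n) set"
  where "algebra_homs R M N = linear_maps R M N \<inter> ring_hom M N"

definition op_algebra :: "('k, 'm, 'd) module_scheme \<Rightarrow> ('k, 'm, 'd) module_scheme"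
  where "op_algebra M = M\<lparr>mult := \<lambda>x y. y \<otimes>\<^bsub>M\<^esub> x\<rparr>"

definition ground_algebra :: "('k, 'c) ring_scheme \<Rightarrow> ('k, 'k) module"
  where "ground_algebra R =
    \<lparr>carrier = carrier R, mult = mult R, one = \<one>\<^bsub>R\<^esub>, zero = \<zero>\<^bsub>R\<^esub>, add = add R, smult = mult R\<rparr>"


section \<open>Tensor products\<close>

text \<open>
  \<open>M \<otimes>\<^sub>R N\<close> is the free module on \<open>carrier M \<times> carrier N\<close> modulo the submodule generated by
  the bilinearity relations; its elements are cosets. The fields \<^const>\<open>mult\<close> and \<^const>\<open>one\<close>
  carry no information in \<open>free_module\<close> and \<open>tensor\<close>.
\<close>

definition free_module :: "('k, 'c) ring_scheme \<Rightarrow> 'x set \<Rightarrow> ('k, 'x \<Rightarrow> 'k) module"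
  where "free_module R X =
    \<lparr>carrier = {f. range f \<subseteq> carrier R \<and> finite {x. f x \<noteq> \<zero>\<^bsub>R\<^esub>} \<and> {x. f x \<noteq> \<zero>\<^bsub>R\<^esub>} \<subseteq> X},
     mult = undefined, one = undefined,
     zero = (\<lambda>x. \<zero>\<^bsub>R\<^esub>), add = (\<lambda>f g x. f x \<oplus>\<^bsub>R\<^esub> g x),
     smult = (\<lambda>c f x. c \<otimes>\<^bsub>R\<^esub> f x)\<rparr>"

definition free_gen :: "('k, 'c) ring_scheme \<Rightarrow> 'x \<Rightarrow> 'x \<Rightarrow> 'k"
  where "free_gen R x = (\<lambda>y. if y = x then \<one>\<^bsub>R\<^esub> else \<zero>\<^bsub>R\<^esub>)"

definition tensor_relations ::
  "('k, 'c) ring_scheme \<Rightarrow> ('k, 'm, 'd) module_scheme \<Rightarrow> ('k, 'n, 'e) module_scheme \<Rightarrow> ('m \<times> 'n \<Rightarrow> 'k) set"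
  where "tensor_relations R M N =
    (let F = free_module R (carrier M \<times> carrier N); e = (\<lambda>m n. free_gen R (m, n)) in
      {e (m \<oplus>\<^bsub>M\<^esub> m') n \<ominus>\<^bsub>F\<^esub> (e m n \<oplus>\<^bsub>F\<^esub> e m' n) | m m' n.
         m \<in> carrier M \<and> m' \<in> carrier M \<and> n \<in> carrier N} \<union>
      {e m (n \<oplus>\<^bsub>N\<^esub> n') \<ominus>\<^bsub>F\<^esub> (e m n \<oplus>\<^bsub>F\<^esub> e m n') | m n n'.
         m \<in> carrier M \<and> n \<in> carrier N \<and> n' \<in> carrier N} \<union>
      {e (c \<odot>\<^bsub>M\<^esub> m) n \<ominus>\<^bsub>F\<^esub> c \<odot>\<^bsub>F\<^esub> e m n | c m n.
         c \<in> carrier R \<and> m \<in> carrier M \<and> n \<in> carrier N} \<union>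
      {e m (c \<odot>\<^bsub>N\<^esub> n) \<ominus>\<^bsub>F\<^esub> c \<odot>\<^bsub>F\<^esub> e m n | c m n.
         c \<in> carrier R \<and> m \<in> carrier M \<and> n \<in> carrier N})"

definition tensor_kernel ::
  "('k, 'c) ring_scheme \<Rightarrow> ('k, 'm, 'd) module_scheme \<Rightarrow> ('k, 'n, 'e) module_scheme \<Rightarrow> ('m \<times> 'n \<Rightarrow> 'k) set"
  where "tensor_kernel R M N =
    \<Inter>{H. submodule H R (free_module R (carrier M \<times> carrier N)) \<and> tensor_relations R M N \<subseteq> H}"

definition tensor ::
  "('k, 'c) ring_scheme \<Rightarrow> ('k, 'm, 'd) module_scheme \<Rightarrow> ('k, 'n, 'e) module_scheme
    \<Rightarrow> ('k, ('m \<times> 'n \<Rightarrow> 'k) set) module"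
  where "tensor R M N =
    (let F = free_module R (carrier M \<times> carrier N); H = tensor_kernel R M N in
      \<lparr>carrier = a_rcosets\<^bsub>F\<^esub> H, mult = undefined, one = undefined,
       zero = H, add = (<+>\<^bsub>F\<^esub>),
       smult = (\<lambda>c X. \<Union>x\<in>X. H +>\<^bsub>F\<^esub> (c \<odot>\<^bsub>F\<^esub> x))\<rparr>)"

definition pure_tensor ::
  "('k, 'c) ring_scheme \<Rightarrow> ('k, 'm, 'd) module_scheme \<Rightarrow> ('k, 'n, 'e) module_scheme
    \<Rightarrow> 'm \<Rightarrow> 'n \<Rightarrow> ('m \<times> 'n \<Rightarrow> 'k) set"
  where "pure_tensor R M N m n =
    tensor_kernel R M N +>\<^bsub>free_module R (carrier M \<times> carrier N)\<^esub> free_gen R (m, n)"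

text \<open>
  The linear map \<open>M \<otimes>\<^sub>R N \<rightarrow> P\<close> induced by a bilinear map \<open>f\<close> on \<open>carrier M \<times> carrier N\<close>.
  Sweedler notation is expressed through it: a formula \<open>f(t\<^sub>(\<^sub>1\<^sub>), t\<^sub>(\<^sub>2\<^sub>))\<close> is
  \<open>tensor_lift R T T P f (\<Delta> t)\<close>.
\<close>

definition tensor_lift ::
  "('k, 'c) ring_scheme \<Rightarrow> ('k, 'm, 'd) module_scheme \<Rightarrow> ('k, 'n, 'e) module_scheme
    \<Rightarrow> ('k, 'p, 'f) module_scheme \<Rightarrow> ('m \<Rightarrow> 'n \<Rightarrow> 'p) \<Rightarrow> ('m \<times> 'n \<Rightarrow> 'k) set \<Rightarrow> 'p"
  where "tensor_lift R M N P f =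
    (THE \<phi>. \<phi> \<in> linear_maps R (tensor R M N) P \<inter> extensional (carrier (tensor R M N)) \<and>
      (\<forall>m\<in>carrier M. \<forall>n\<in>carrier N. \<phi> (pure_tensor R M N m n) = f m n))"

definition tensor_map ::
  "('k, 'c) ring_scheme \<Rightarrow> ('k, 'm, 'd) module_scheme \<Rightarrow> ('k, 'n, 'e) module_scheme
    \<Rightarrow> ('k, 'm1, 'd1) module_scheme \<Rightarrow> ('k, 'n1, 'e1) module_scheme
    \<Rightarrow> ('m \<Rightarrow> 'm1) \<Rightarrow> ('n \<Rightarrow> 'n1) \<Rightarrow> ('m \<times> 'n \<Rightarrow> 'k) set \<Rightarrow> ('m1 \<times> 'n1 \<Rightarrow> 'k) set"
  where "tensor_map R M N M' N' f g =
    tensor_lift R M N (tensor R M' N') (\<lambda>m n. pure_tensor R M' N' (f m) (g n))"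

text \<open>The associativity isomorphism \<open>(M \<otimes> N) \<otimes> P \<rightarrow> M \<otimes> (N \<otimes> P)\<close>.\<close>

definition tensor_assoc ::
  "('k, 'c) ring_scheme \<Rightarrow> ('k, 'm, 'd) module_scheme \<Rightarrow> ('k, 'n, 'e) module_scheme
    \<Rightarrow> ('k, 'p, 'f) module_scheme
    \<Rightarrow> (('m \<times> 'n \<Rightarrow> 'k) set \<times> 'p \<Rightarrow> 'k) set \<Rightarrow> ('m \<times> ('n \<times> 'p \<Rightarrow> 'k) set \<Rightarrow> 'k) set"
  where "tensor_assoc R M N P =
    tensor_lift R (tensor R M N) P (tensor R M (tensor R N P))
      (\<lambda>u p. tensor_lift R M N (tensor R M (tensor R N P))
        (\<lambda>m n. pure_tensor R M (tensor R N P) m (pure_tensor R N P n p)) u)"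

definition tensor_algebra ::
  "('k, 'c) ring_scheme \<Rightarrow> ('k, 'm, 'd) module_scheme \<Rightarrow> ('k, 'n, 'e) module_scheme
    \<Rightarrow> ('k, ('m \<times> 'n \<Rightarrow> 'k) set) module"
  where "tensor_algebra R M N = (tensor R M N)\<lparr>
    mult := (\<lambda>u v. tensor_lift R M N (tensor R M N)
      (\<lambda>m n. tensor_lift R M N (tensor R M N)
        (\<lambda>m' n'. pure_tensor R M N (m \<otimes>\<^bsub>M\<^esub> m') (n \<otimes>\<^bsub>N\<^esub> n')) v) u),
    one := pure_tensor R M N \<one>\<^bsub>M\<^esub> \<one>\<^bsub>N\<^esub>\<rparr>"


section \<open>Hopf algebras\<close>

locale hopf_algebra = R?: field R + assoc_algebra R T
  for R :: "('k, 'c) ring_scheme" (structure) and T :: "('k, 't, 'd) module_scheme" (structure) +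
  fixes \<Delta> :: "'t \<Rightarrow> ('t \<times> 't \<Rightarrow> 'k) set"
    and \<epsilon> :: "'t \<Rightarrow> 'k"
    and S :: "'t \<Rightarrow> 't"
  assumes comult_hom: "\<Delta> \<in> algebra_homs R T (tensor_algebra R T T)"
    and counit_hom: "\<epsilon> \<in> algebra_homs R T (ground_algebra R)"
    and coassoc: "t \<in> carrier T \<Longrightarrow>
      tensor_assoc R T T T (tensor_map R T T (tensor R T T) T \<Delta> (\<lambda>x. x) (\<Delta> t)) =
      tensor_map R T T T (tensor R T T) (\<lambda>x. x) \<Delta> (\<Delta> t)"
    and counit_left: "t \<in> carrier T \<Longrightarrow>
      tensor_lift R T T T (\<lambda>t\<^sub>1 t\<^sub>2. \<epsilon> t\<^sub>1 \<odot>\<^bsub>T\<^esub> t\<^sub>2) (\<Delta> t) = t"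
    and counit_right: "t \<in> carrier T \<Longrightarrow>
      tensor_lift R T T T (\<lambda>t\<^sub>1 t\<^sub>2. \<epsilon> t\<^sub>2 \<odot>\<^bsub>T\<^esub> t\<^sub>1) (\<Delta> t) = t"
    and antipode_linear: "S \<in> linear_maps R T T"
    and antipode_left: "t \<in> carrier T \<Longrightarrow>
      tensor_lift R T T T (\<lambda>t\<^sub>1 t\<^sub>2. S t\<^sub>1 \<otimes>\<^bsub>T\<^esub> t\<^sub>2) (\<Delta> t) = \<epsilon> t \<odot>\<^bsub>T\<^esub> \<one>\<^bsub>T\<^esub>"
    and antipode_right: "t \<in> carrier T \<Longrightarrow>
      tensor_lift R T T T (\<lambda>t\<^sub>1 t\<^sub>2. t\<^sub>1 \<otimes>\<^bsub>T\<^esub> S t\<^sub>2) (\<Delta> t) = \<epsilon> t \<odot>\<^bsub>T\<^esub> \<one>\<^bsub>T\<^esub>"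


section \<open>Braided-commutative Yetter-Drinfeld module algebras\<close>

text \<open>
  Left-right Yetter-Drinfeld module algebras, with left action \<open>act t a = t \<triangleright> a\<close> and right
  coaction \<open>\<rho> a = a\<^sub>[\<^sub>0\<^sub>] \<otimes> a\<^sub>[\<^sub>1\<^sub>]\<close>. As a module \<open>tensor R A T\<close> coincides with
  \<open>tensor R A (op_algebra T)\<close>; the opposite product only matters in \<open>coaction_hom\<close>.
\<close>

locale yetter_drinfeld_module_algebra = hopf_algebra R T \<Delta> \<epsilon> S + A?: assoc_algebra R A
  for R :: "('k, 'c) ring_scheme" (structure) and T :: "('k, 't, 'd) module_scheme" (structure)
    and \<Delta> \<epsilon> S and A :: "('k, 'a, 'e) module_scheme" (structure) +
  fixes act :: "'t \<Rightarrow> 'a \<Rightarrow> 'a"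
    and \<rho> :: "'a \<Rightarrow> ('a \<times> 't \<Rightarrow> 'k) set"
  assumes act_linear_right: "t \<in> carrier T \<Longrightarrow> act t \<in> linear_maps R A A"
    and act_linear_left: "a \<in> carrier A \<Longrightarrow> (\<lambda>t. act t a) \<in> linear_maps R T A"
    and act_one: "a \<in> carrier A \<Longrightarrow> act \<one>\<^bsub>T\<^esub> a = a"
    and act_mult: "\<lbrakk>t \<in> carrier T; t' \<in> carrier T; a \<in> carrier A\<rbrakk>
      \<Longrightarrow> act (t \<otimes>\<^bsub>T\<^esub> t') a = act t (act t' a)"
    and act_prod: "\<lbrakk>t \<in> carrier T; a \<in> carrier A; b \<in> carrier A\<rbrakk>
      \<Longrightarrow> act t (a \<otimes>\<^bsub>A\<^esub> b) = tensor_lift R T T A (\<lambda>t\<^sub>1 t\<^sub>2. act t\<^sub>1 a \<otimes>\<^bsub>A\<^esub> act t\<^sub>2 b) (\<Delta> t)"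
    and act_unit: "t \<in> carrier T \<Longrightarrow> act t \<one>\<^bsub>A\<^esub> = \<epsilon> t \<odot>\<^bsub>A\<^esub> \<one>\<^bsub>A\<^esub>"
    and coaction_hom: "\<rho> \<in> algebra_homs R A (tensor_algebra R A (op_algebra T))"
    and coaction_coassoc: "a \<in> carrier A \<Longrightarrow>
      tensor_assoc R A T T (tensor_map R A T (tensor R A T) T \<rho> (\<lambda>x. x) (\<rho> a)) =
      tensor_map R A T A (tensor R T T) (\<lambda>x. x) \<Delta> (\<rho> a)"
    and coaction_counit: "a \<in> carrier A \<Longrightarrow>
      tensor_lift R A T A (\<lambda>a\<^sub>0 a\<^sub>1. \<epsilon> a\<^sub>1 \<odot>\<^bsub>A\<^esub> a\<^sub>0) (\<rho> a) = a"
    and yetter_drinfeld: "\<lbrakk>t \<in> carrier T; a \<in> carrier A\<rbrakk> \<Longrightarrow>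
      tensor_lift R T T (tensor R A T)
        (\<lambda>t\<^sub>1 t\<^sub>2. tensor_lift R A T (tensor R A T)
          (\<lambda>a\<^sub>0 a\<^sub>1. pure_tensor R A T (act t\<^sub>1 a\<^sub>0) (t\<^sub>2 \<otimes>\<^bsub>T\<^esub> a\<^sub>1)) (\<rho> a)) (\<Delta> t) =
      tensor_lift R T T (tensor R A T)
        (\<lambda>t\<^sub>1 t\<^sub>2. tensor_lift R A T (tensor R A T)
          (\<lambda>b\<^sub>0 b\<^sub>1. pure_tensor R A T b\<^sub>0 (b\<^sub>1 \<otimes>\<^bsub>T\<^esub> t\<^sub>1)) (\<rho> (act t\<^sub>2 a))) (\<Delta> t)"

locale braided_commutative_yd_algebra = yetter_drinfeld_module_algebra +
  assumes braided_commutative: "\<lbrakk>x \<in> carrier A; a \<in> carrier A\<rbrakk> \<Longrightarrow>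
    tensor_lift R A T A (\<lambda>x\<^sub>0 x\<^sub>1. x\<^sub>0 \<otimes>\<^bsub>A\<^esub> act x\<^sub>1 a) (\<rho> x) = a \<otimes>\<^bsub>A\<^esub> x"


section \<open>The smash product algebra and the map \<open>\<tau>\<close>\<close>

definition smash ::
  "('k, 'c) ring_scheme \<Rightarrow> ('k, 't, 'd) module_scheme \<Rightarrow> ('t \<Rightarrow> ('t \<times> 't \<Rightarrow> 'k) set)
    \<Rightarrow> ('k, 'a, 'e) module_scheme \<Rightarrow> ('t \<Rightarrow> 'a \<Rightarrow> 'a) \<Rightarrow> ('k, ('a \<times> 't \<Rightarrow> 'k) set) module"
  where "smash R T \<Delta> A act = (tensor R A T)\<lparr>
    mult := (\<lambda>u v. tensor_lift R A T (tensor R A T)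
      (\<lambda>a t. tensor_lift R A T (tensor R A T)
        (\<lambda>a' t'. tensor_lift R T T (tensor R A T)
          (\<lambda>t\<^sub>1 t\<^sub>2. pure_tensor R A T (a \<otimes>\<^bsub>A\<^esub> act t\<^sub>1 a') (t\<^sub>2 \<otimes>\<^bsub>T\<^esub> t')) (\<Delta> t)) v) u),
    one := pure_tensor R A T \<one>\<^bsub>A\<^esub> \<one>\<^bsub>T\<^esub>\<rparr>"

definition smash_left ::
  "('k, 'c) ring_scheme \<Rightarrow> ('k, 't, 'd) module_scheme \<Rightarrow> ('k, 'a, 'e) module_scheme
    \<Rightarrow> 'a \<Rightarrow> ('a \<times> 't \<Rightarrow> 'k) set"
  where "smash_left R T A a = pure_tensor R A T a \<one>\<^bsub>T\<^esub>"

definition smash_right ::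
  "('k, 'c) ring_scheme \<Rightarrow> ('k, 't, 'd) module_scheme \<Rightarrow> ('k, 'a, 'e) module_scheme
    \<Rightarrow> 't \<Rightarrow> ('a \<times> 't \<Rightarrow> 'k) set"
  where "smash_right R T A t = pure_tensor R A T \<one>\<^bsub>A\<^esub> t"

definition smash_tau ::
  "('k, 'c) ring_scheme \<Rightarrow> ('k, 't, 'd) module_scheme \<Rightarrow> ('t \<Rightarrow> ('t \<times> 't \<Rightarrow> 'k) set) \<Rightarrow> ('t \<Rightarrow> 't)
    \<Rightarrow> ('k, 'a, 'e) module_scheme \<Rightarrow> ('t \<Rightarrow> 'a \<Rightarrow> 'a) \<Rightarrow> ('a \<Rightarrow> ('a \<times> 't \<Rightarrow> 'k) set)
    \<Rightarrow> ('a \<times> 't \<Rightarrow> 'k) set \<Rightarrow> ('a \<times> 't \<Rightarrow> 'k) set"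
  where "smash_tau R T \<Delta> S A act \<rho> =
    tensor_lift R A T (smash R T \<Delta> A act)
      (\<lambda>a t. tensor_lift R A T (smash R T \<Delta> A act)
        (\<lambda>a\<^sub>0 a\<^sub>1. smash_right R T A (S t \<otimes>\<^bsub>T\<^esub> S (S a\<^sub>1))
          \<otimes>\<^bsub>smash R T \<Delta> A act\<^esub> smash_left R T A a\<^sub>0) (\<rho> a))"

definition distinguished_generators ::
  "('k, 'c) ring_scheme \<Rightarrow> ('k, 't, 'd) module_scheme \<Rightarrow> ('t \<Rightarrow> ('t \<times> 't \<Rightarrow> 'k) set) \<Rightarrow> ('t \<Rightarrow> 't)
    \<Rightarrow> ('k, 'a, 'e) module_scheme \<Rightarrow> ('t \<Rightarrow> 'a \<Rightarrow> 'a) \<Rightarrow> ('a \<Rightarrow> ('a \<times> 't \<Rightarrow> 'k) set)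
    \<Rightarrow> (('a \<times> 't \<Rightarrow> 'k) set \<times> ('a \<times> 't \<Rightarrow> 'k) set \<Rightarrow> 'k) set set"
  where "distinguished_generators R T \<Delta> S A act \<rho> =
    (let B = smash R T \<Delta> A act; i = smash_left R T A; j = smash_right R T A in
      {pure_tensor R B B (i x) \<one>\<^bsub>B\<^esub> | x. x \<in> carrier A} \<union>
      {tensor_lift R A T (tensor R B B)
         (\<lambda>x\<^sub>0 x\<^sub>1. pure_tensor R B B (j (S x\<^sub>1)) (i x\<^sub>0)) (\<rho> x) | x. x \<in> carrier A} \<union>
      {tensor_lift R T T (tensor R B B)
         (\<lambda>f\<^sub>1 f\<^sub>2. pure_tensor R B B (j f\<^sub>1) (j f\<^sub>2)) (\<Delta> f) | f. f \<in> carrier T})"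

end

theory Submission
  imports Defs
begin

text \<open>
  The map \<open>u \<otimes> v \<mapsto> u \<cdot> a \<cdot> \<tau>(v)\<close> is linear on the tensor square of the smash product, so it suffices
  to evaluate it on the generators. The point is that \<open>t\<^sub>(\<^sub>1\<^sub>) \<cdot> a \<cdot> S(t\<^sub>(\<^sub>2\<^sub>)) = t \<triangleright> a\<close> in the smash
  product. For \<open>f\<^sub>(\<^sub>1\<^sub>) \<otimes> f\<^sub>(\<^sub>2\<^sub>)\<close> this gives \<open>f \<triangleright> a\<close> at once, since \<open>\<tau>(t) = S(t)\<close> for \<open>t\<close> in \<open>T\<close>. For
  \<open>S(x\<^sub>[\<^sub>1\<^sub>]) \<otimes> x\<^sub>[\<^sub>0\<^sub>]\<close>, coassociativity of the coaction leads to
  \<open>S(x\<^sub>[\<^sub>1\<^sub>]\<^sub>(\<^sub>2\<^sub>)) \<cdot> a \<cdot> S\<^sup>2(x\<^sub>[\<^sub>1\<^sub>]\<^sub>(\<^sub>1\<^sub>)) \<cdot> x\<^sub>[\<^sub>0\<^sub>]\<close>; as \<open>S\<close> reverses the coproduct, the first three factors are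
  the same expression for \<open>t = S(x\<^sub>[\<^sub>1\<^sub>])\<close>, and the result is \<open>(S(x\<^sub>[\<^sub>1\<^sub>]) \<triangleright> a) x\<^sub>[\<^sub>0\<^sub>]\<close>. The coproduct is
  reversed because \<open>\<Delta> \<circ> S\<close> and \<open>t \<mapsto> S(t\<^sub>(\<^sub>2\<^sub>)) \<otimes> S(t\<^sub>(\<^sub>1\<^sub>))\<close> are both convolution inverses of \<open>\<Delta>\<close>.
\<close>

section \<open>Linear maps\<close>

lemma linear_mapsI:
  assumes "\<And>x. x \<in> carrier M \<Longrightarrow> f x \<in> carrier N"
    and "\<And>x y. \<lbrakk>x \<in> carrier M; y \<in> carrier M\<rbrakk> \<Longrightarrow> f (x \<oplus>\<^bsub>M\<^esub> y) = f x \<oplus>\<^bsub>N\<^esub> f y"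
    and "\<And>c x. \<lbrakk>c \<in> carrier R; x \<in> carrier M\<rbrakk> \<Longrightarrow> f (c \<odot>\<^bsub>M\<^esub> x) = c \<odot>\<^bsub>N\<^esub> f x"
  shows "f \<in> linear_maps R M N"
  using assms by (auto simp: linear_maps_def)

lemma linear_mapsD:
  assumes "f \<in> linear_maps R M N"
  shows "x \<in> carrier M \<Longrightarrow> f x \<in> carrier N"
    and "\<lbrakk>x \<in> carrier M; y \<in> carrier M\<rbrakk> \<Longrightarrow> f (x \<oplus>\<^bsub>M\<^esub> y) = f x \<oplus>\<^bsub>N\<^esub> f y"
    and "\<lbrakk>c \<in> carrier R; x \<in> carrier M\<rbrakk> \<Longrightarrow> f (c \<odot>\<^bsub>M\<^esub> x) = c \<odot>\<^bsub>N\<^esub> f x"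
  using assms by (auto simp: linear_maps_def)

lemma linear_maps_zero:
  assumes "module R M" "module R N" "f \<in> linear_maps R M N"
  shows "f \<zero>\<^bsub>M\<^esub> = \<zero>\<^bsub>N\<^esub>"
proof -
  interpret M: module R M by fact
  interpret N: module R N by fact
  have "f (\<zero>\<^bsub>R\<^esub> \<odot>\<^bsub>M\<^esub> \<zero>\<^bsub>M\<^esub>) = \<zero>\<^bsub>R\<^esub> \<odot>\<^bsub>N\<^esub> f \<zero>\<^bsub>M\<^esub>"
    using linear_mapsD(3)[OF assms(3)] by blast
  then show ?thesis using linear_mapsD(1)[OF assms(3)] by simp
qed

lemma linear_maps_minus:
  assumes "module R M" "module R N" "f \<in> linear_maps R M N" "x \<in> carrier M"
  shows "f (\<ominus>\<^bsub>M\<^esub> x) = \<ominus>\<^bsub>N\<^esub> f x"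
proof -
  interpret M: module R M by fact
  interpret N: module R N by fact
  have "f (\<ominus>\<^bsub>M\<^esub> x) \<oplus>\<^bsub>N\<^esub> f x = f (\<ominus>\<^bsub>M\<^esub> x \<oplus>\<^bsub>M\<^esub> x)"
    using linear_mapsD(2)[OF assms(3)] assms(4) by simp
  also have "\<dots> = \<zero>\<^bsub>N\<^esub>"
    using linear_maps_zero[OF assms(1-3)] assms(4) by (simp add: M.M.l_neg)
  finally show ?thesis
    using linear_mapsD(1)[OF assms(3)] assms(4) by (simp add: N.M.minus_equality)
qed

lemma linear_maps_finsum:
  assumes "module R M" "module R N" "f \<in> linear_maps R M N" "finite I" "g \<in> I \<rightarrow> carrier M"
  shows "f (\<Oplus>\<^bsub>M\<^esub>i\<in>I. g i) = (\<Oplus>\<^bsub>N\<^esub>i\<in>I. f (g i))"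
proof -
  interpret M: module R M by fact
  interpret N: module R N by fact
  note f = linear_mapsD[OF assms(3)]
  show ?thesis using assms(4,5)
  proof (induction I rule: finite_induct)
    case empty
    then show ?case using linear_maps_zero[OF assms(1-3)] by simp
  next
    case (insert i I)
    then show ?case using f by (simp add: Pi_def)
  qed
qed

text \<open>Serves to pass from "the bilinearity relations are killed" to "the whole submodule
  generated by them is killed".\<close>

lemma linear_maps_kernel_submodule:
  assumes "module R M" "module R N" "f \<in> linear_maps R M N"
  shows "submodule {x \<in> carrier M. f x = \<zero>\<^bsub>N\<^esub>} R M"
proof -
  interpret M: module R M by fact
  interpret N: module R N by fact
  note f = linear_mapsD[OF assms(3)]
  show ?thesis
    by (rule M.submoduleI)
      (auto simp: f linear_maps_zero[OF assms] linear_maps_minus[OF assms])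
qed

lemma linear_maps_comp:
  assumes "g \<in> linear_maps R N P" "f \<in> linear_maps R M N"
  shows "(\<lambda>x. g (f x)) \<in> linear_maps R M P"
  by (rule linear_mapsI) (simp_all add: linear_mapsD[OF assms(1)] linear_mapsD[OF assms(2)])

text \<open>\<open>tensor_lift\<close> singles out its map among the extensional ones; restriction
  supplies such a representative.\<close>

lemma linear_maps_restrict:
  assumes "module R M" "f \<in> linear_maps R M N"
  shows "restrict f (carrier M) \<in> linear_maps R M N"
proof -
  interpret M: module R M by fact
  show ?thesis
    by (rule linear_mapsI) (auto simp: linear_mapsD[OF assms(2)])
qed

section \<open>Free modules\<close>

lemma free_module_sel:
  "carrier (free_module R X) =
     {f. range f \<subseteq> carrier R \<and> finite {x. f x \<noteq> \<zero>\<^bsub>R\<^esub>} \<and> {x. f x \<noteq> \<zero>\<^bsub>R\<^esub>} \<subseteq> X}"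
  "\<zero>\<^bsub>free_module R X\<^esub> = (\<lambda>x. \<zero>\<^bsub>R\<^esub>)"
  "f \<oplus>\<^bsub>free_module R X\<^esub> g = (\<lambda>x. f x \<oplus>\<^bsub>R\<^esub> g x)"
  "c \<odot>\<^bsub>free_module R X\<^esub> f = (\<lambda>x. c \<otimes>\<^bsub>R\<^esub> f x)"
  by (simp_all add: free_module_def)

lemma free_module_carrierD:
  assumes "f \<in> carrier (free_module R X)"
  shows "f x \<in> carrier R" "finite {x. f x \<noteq> \<zero>\<^bsub>R\<^esub>}" "f x \<noteq> \<zero>\<^bsub>R\<^esub> \<Longrightarrow> x \<in> X"
  using assms by (auto simp: free_module_sel)

lemma free_module_carrierI:
  assumes "\<And>x. f x \<in> carrier R" "finite S" "S \<subseteq> X" "\<And>x. x \<notin> S \<Longrightarrow> f x = \<zero>\<^bsub>R\<^esub>"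
  shows "f \<in> carrier (free_module R X)"
proof -
  have "{x. f x \<noteq> \<zero>\<^bsub>R\<^esub>} \<subseteq> S" using assms(4) by auto
  then show ?thesis
    using assms(1-3) finite_subset[OF _ assms(2)] by (auto simp: free_module_sel)
qed

lemma (in cring) free_module_module: "module R (free_module R X)"
proof -
  let ?F = "free_module R X"
  have val: "f x \<in> carrier R" if "f \<in> carrier ?F" for f x
    using free_module_carrierD(1)[OF that] .
  have add: "f \<oplus>\<^bsub>?F\<^esub> g \<in> carrier ?F" if "f \<in> carrier ?F" "g \<in> carrier ?F" for f g
    unfolding free_module_sel(3)
    by (rule free_module_carrierI[where S="{x. f x \<noteq> \<zero>} \<union> {x. g x \<noteq> \<zero>}"])
      (use free_module_carrierD[OF that(1)] free_module_carrierD[OF that(2)] in auto)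
  have smult: "c \<odot>\<^bsub>?F\<^esub> f \<in> carrier ?F" if "c \<in> carrier R" "f \<in> carrier ?F" for c f
    unfolding free_module_sel(4)
    by (rule free_module_carrierI[where S="{x. f x \<noteq> \<zero>}"])
      (use free_module_carrierD[OF that(2)] that(1) in auto)
  have "abelian_group ?F"
  proof (rule abelian_groupI)
    show "\<zero>\<^bsub>?F\<^esub> \<in> carrier ?F" by (auto simp: free_module_sel)
    fix f assume f: "f \<in> carrier ?F"
    \<comment> \<open>The negative is taken to be (-1) times f, so that its finite support comes
      from closure under scalars.\<close>
    show "\<exists>g\<in>carrier ?F. g \<oplus>\<^bsub>?F\<^esub> f = \<zero>\<^bsub>?F\<^esub>"
      by (rule bexI[of _ "(\<ominus> \<one>) \<odot>\<^bsub>?F\<^esub> f"])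
        (use free_module_carrierD(1)[OF f] smult[OF _ f, of "\<ominus> \<one>"] in
          \<open>simp_all add: free_module_sel(2,3,4) l_minus l_neg del: free_module_sel(1)\<close>)
  qed (use add val in \<open>auto simp: free_module_sel(2,3) a_ac intro!: ext\<close>)
  then show ?thesis
    by (rule moduleI[OF is_cring])
      (use smult val in \<open>auto simp: free_module_sel(3,4) l_distr r_distr m_assoc intro!: ext\<close>)
qed

lemma (in cring) free_gen_closed: "x \<in> X \<Longrightarrow> free_gen R x \<in> carrier (free_module R X)"
  by (rule free_module_carrierI[where S="{x}"]) (auto simp: free_gen_def)

text \<open>Induction on a finite set containing the support: peeling off the value at one point
  leaves a function supported on a smaller set.\<close>

lemma (in cring) free_module_induct [consumes 1, case_names zero add]:
  assumes g: "g \<in> carrier (free_module R X)"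
    and zero: "P \<zero>\<^bsub>free_module R X\<^esub>"
    and add: "\<And>c x g. \<lbrakk>c \<in> carrier R; x \<in> X; g \<in> carrier (free_module R X); P g\<rbrakk>
      \<Longrightarrow> P (c \<odot>\<^bsub>free_module R X\<^esub> free_gen R x \<oplus>\<^bsub>free_module R X\<^esub> g)"
  shows "P g"
proof -
  let ?F = "free_module R X"
  have "\<forall>g\<in>carrier ?F. {x. g x \<noteq> \<zero>} \<subseteq> S \<longrightarrow> P g" if "finite S" for S
    using that
  proof (induction S rule: finite_induct)
    case empty
    show ?case
    proof (intro ballI impI)
      fix g assume "g \<in> carrier ?F" "{x. g x \<noteq> \<zero>} \<subseteq> {}"
      then have "g = \<zero>\<^bsub>free_module R X\<^esub>" by (auto simp: free_module_sel(2))
      then show "P g" using zero by simp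
    qed
  next
    case (insert y S)
    show ?case
    proof (intro ballI impI)
      fix g assume g: "g \<in> carrier ?F" and S: "{x. g x \<noteq> \<zero>} \<subseteq> insert y S"
      note gD = free_module_carrierD[OF g]
      \<comment> \<open>Erasing the value at \<open>y\<close> brings the support into
        \<open>S\<close>, where the induction hypothesis applies.\<close>
      define h where "h = g(y := \<zero>)"
      have h: "h \<in> carrier ?F"
        unfolding h_def
        by (rule free_module_carrierI[where S="{x. g x \<noteq> \<zero>}"]) (use gD in auto)
      moreover have "{x. h x \<noteq> \<zero>} \<subseteq> S" using S by (auto simp: h_def)
      ultimately have Ph: "P h" using insert.IH by blast
      show "P g"
      proof (cases "g y = \<zero>")
        case True
        then have "h = g" by (auto simp: h_def)
        then show ?thesis using Ph by simp
      next
        case False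
        have "g = g y \<odot>\<^bsub>?F\<^esub> free_gen R y \<oplus>\<^bsub>?F\<^esub> h"
          using gD(1) by (auto simp: free_module_sel(3,4) free_gen_def h_def)
        then show ?thesis
          using add[OF gD(1)[of y] gD(3)[OF False] h Ph] by simp
      qed
    qed
  qed
  then show ?thesis using free_module_carrierD(2)[OF g] g by blast
qed

text \<open>The universal property of the free module: the extension is the linear combination of
  the values of \<open>h\<close> with the coefficients of g, summed over the support of g.\<close>

lemma free_module_lift_exists:
  assumes "module R P" "h \<in> X \<rightarrow> carrier P"
  obtains \<phi> where "\<phi> \<in> linear_maps R (free_module R X) P" "\<And>x. x \<in> X \<Longrightarrow> \<phi> (free_gen R x) = h x"
proof -
  interpret P: module R P by fact
  let ?F = "free_module R X"
  define \<phi> where "\<phi> g = (\<Oplus>\<^bsub>P\<^esub>x\<in>{x. g x \<noteq> \<zero>\<^bsub>R\<^esub>}. g x \<odot>\<^bsub>P\<^esub> h x)" for g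
  have hX: "h x \<in> carrier P" if "x \<in> X" for x using assms(2) that by auto
  \<comment> \<open>Supports change under addition and scaling, so the sums must first be compared
    over a common finite superset of the support; the added terms have coefficient zero.\<close>
  have \<phi>: "\<phi> g = (\<Oplus>\<^bsub>P\<^esub>x\<in>S. g x \<odot>\<^bsub>P\<^esub> h x)"
    if "g \<in> carrier ?F" "finite S" "S \<subseteq> X" "{x. g x \<noteq> \<zero>\<^bsub>R\<^esub>} \<subseteq> S" for g S
    unfolding \<phi>_def
    by (rule P.M.add.finprod_mono_neutral_cong_left)
      (use that hX free_module_carrierD[OF that(1)] in auto)
  have supp: "{x. g x \<noteq> \<zero>\<^bsub>R\<^esub>} \<subseteq> X" "finite {x. g x \<noteq> \<zero>\<^bsub>R\<^esub>}" "\<phi> g \<in> carrier P"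
    if "g \<in> carrier ?F" for g
    unfolding \<phi>_def
    using free_module_carrierD[OF that] hX by (auto intro!: P.M.finsum_closed)
  interpret F: module R ?F by (rule P.R.free_module_module)
  have lin: "\<phi> \<in> linear_maps R ?F P"
  proof (rule linear_mapsI)
    fix f g assume fg: "f \<in> carrier ?F" "g \<in> carrier ?F"
    let ?S = "{x. f x \<noteq> \<zero>\<^bsub>R\<^esub>} \<union> {x. g x \<noteq> \<zero>\<^bsub>R\<^esub>}"
    have S: "finite ?S" "?S \<subseteq> X" using supp fg by auto
    note c = free_module_carrierD(1)[OF fg(1)] free_module_carrierD(1)[OF fg(2)]
    have "\<phi> (f \<oplus>\<^bsub>?F\<^esub> g) = (\<Oplus>\<^bsub>P\<^esub>x\<in>?S. (f \<oplus>\<^bsub>?F\<^esub> g) x \<odot>\<^bsub>P\<^esub> h x)"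
      by (rule \<phi>) (use F.a_closed[OF fg] S in \<open>auto simp: free_module_sel(3)\<close>)
    also have "\<dots> = (\<Oplus>\<^bsub>P\<^esub>x\<in>?S. f x \<odot>\<^bsub>P\<^esub> h x \<oplus>\<^bsub>P\<^esub> g x \<odot>\<^bsub>P\<^esub> h x)"
      by (rule P.M.finsum_cong')
        (use S hX c in \<open>auto simp: free_module_sel(3) P.smult_l_distr\<close>)
    also have "\<dots> = (\<Oplus>\<^bsub>P\<^esub>x\<in>?S. f x \<odot>\<^bsub>P\<^esub> h x) \<oplus>\<^bsub>P\<^esub> (\<Oplus>\<^bsub>P\<^esub>x\<in>?S. g x \<odot>\<^bsub>P\<^esub> h x)"
      by (rule P.M.finsum_addf) (use S hX c in auto)
    also have "\<dots> = \<phi> f \<oplus>\<^bsub>P\<^esub> \<phi> g"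
      using \<phi>[OF fg(1) S] \<phi>[OF fg(2) S] by simp
    finally show "\<phi> (f \<oplus>\<^bsub>?F\<^esub> g) = \<phi> f \<oplus>\<^bsub>P\<^esub> \<phi> g" .
  next
    fix c f assume cf: "c \<in> carrier R" "f \<in> carrier ?F"
    let ?S = "{x. f x \<noteq> \<zero>\<^bsub>R\<^esub>}"
    have S: "finite ?S" "?S \<subseteq> X" using supp cf by auto
    note fc = free_module_carrierD(1)[OF cf(2)]
    have "\<phi> (c \<odot>\<^bsub>?F\<^esub> f) = (\<Oplus>\<^bsub>P\<^esub>x\<in>?S. (c \<odot>\<^bsub>?F\<^esub> f) x \<odot>\<^bsub>P\<^esub> h x)"
      by (rule \<phi>) (use F.smult_closed[OF cf] cf S in \<open>auto simp: free_module_sel(4)\<close>)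
    also have "\<dots> = (\<Oplus>\<^bsub>P\<^esub>x\<in>?S. c \<odot>\<^bsub>P\<^esub> (f x \<odot>\<^bsub>P\<^esub> h x))"
      by (rule P.M.finsum_cong')
        (use S hX cf fc in \<open>auto simp: free_module_sel(4) P.smult_assoc1\<close>)
    also have "\<dots> = c \<odot>\<^bsub>P\<^esub> \<phi> f"
      unfolding \<phi>_def
      by (rule P.finsum_smult_ldistr[symmetric]) (use S hX cf fc in auto)
    finally show "\<phi> (c \<odot>\<^bsub>?F\<^esub> f) = c \<odot>\<^bsub>P\<^esub> \<phi> f" .
  qed (use supp in auto)
  have "\<phi> (free_gen R x) = h x" if x: "x \<in> X" for x
  proof -
    have "\<phi> (free_gen R x) = (\<Oplus>\<^bsub>P\<^esub>y\<in>{x}. free_gen R x y \<odot>\<^bsub>P\<^esub> h y)"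
      by (rule \<phi>) (use P.R.free_gen_closed[OF x] x in \<open>auto simp: free_gen_def\<close>)
    then show ?thesis using hX[OF x] by (simp add: free_gen_def)
  qed
  then show thesis using lin that by blast
qed

section \<open>Quotient modules and tensor products\<close>

locale quotient_module = module R F + submodule H R F for R (structure) and F (structure) and H
begin

sublocale abelian_subgroup H F
  by (rule abelian_subgroupI3) (unfold_locales)

text \<open>The record repeats the one in \<open>tensor\<close> field by field, so that a tensor
  product is literally an instance of this quotient.\<close>

definition Q where
  "Q = \<lparr>carrier = a_rcosets\<^bsub>F\<^esub> H, mult = undefined, one = undefined,
       zero = H, add = (<+>\<^bsub>F\<^esub>), smult = (\<lambda>c X. \<Union>x\<in>X. H +>\<^bsub>F\<^esub> (c \<odot>\<^bsub>F\<^esub> x))\<rparr>"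

lemma Q_carrier: "carrier Q = (\<lambda>x. H +>\<^bsub>F\<^esub> x) ` carrier F"
  by (auto simp: Q_def A_RCOSETS_def')

lemma Q_zero: "\<zero>\<^bsub>Q\<^esub> = H +>\<^bsub>F\<^esub> \<zero>\<^bsub>F\<^esub>"
  using a_subset by (simp add: Q_def)

lemma Q_add: "\<lbrakk>x \<in> carrier F; y \<in> carrier F\<rbrakk> \<Longrightarrow> (H +>\<^bsub>F\<^esub> x) \<oplus>\<^bsub>Q\<^esub> (H +>\<^bsub>F\<^esub> y) = H +>\<^bsub>F\<^esub> (x \<oplus>\<^bsub>F\<^esub> y)"
  by (simp add: Q_def a_rcos_sum)

lemma coset_eq_iff:
  "\<lbrakk>x \<in> carrier F; y \<in> carrier F\<rbrakk> \<Longrightarrow> H +>\<^bsub>F\<^esub> x = H +>\<^bsub>F\<^esub> y \<longleftrightarrow> x \<ominus>\<^bsub>F\<^esub> y \<in> H"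
  using a_rcos_module[of y x] a_rcos_self[of x] a_repr_independence[of x H y] a_subgroup
  by (auto simp: a_minus_def)

text \<open>The scalar product is a union of cosets over all representatives. \<open>H\<close> is
  closed under scalars, so these cosets coincide, and the union collapses because the coset is
  nonempty.\<close>

lemma Q_smult:
  assumes "c \<in> carrier R" "x \<in> carrier F"
  shows "c \<odot>\<^bsub>Q\<^esub> (H +>\<^bsub>F\<^esub> x) = H +>\<^bsub>F\<^esub> (c \<odot>\<^bsub>F\<^esub> x)"
proof -
  have "H +>\<^bsub>F\<^esub> (c \<odot>\<^bsub>F\<^esub> y) = H +>\<^bsub>F\<^esub> (c \<odot>\<^bsub>F\<^esub> x)" if y: "y \<in> H +>\<^bsub>F\<^esub> x" for y
  proof -
    have yF: "y \<in> carrier F" using a_elemrcos_carrier[OF assms(2) y] .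
    have "y \<ominus>\<^bsub>F\<^esub> x \<in> H" using y yF assms(2) using a_rcos_module[of x y] by (simp add: a_minus_def)
    then have "c \<odot>\<^bsub>F\<^esub> (y \<ominus>\<^bsub>F\<^esub> x) \<in> H" using assms by blast
    moreover have "c \<odot>\<^bsub>F\<^esub> (y \<ominus>\<^bsub>F\<^esub> x) = c \<odot>\<^bsub>F\<^esub> y \<ominus>\<^bsub>F\<^esub> c \<odot>\<^bsub>F\<^esub> x"
      using assms yF by (simp add: a_minus_def smult_r_distr smult_r_minus)
    ultimately show ?thesis using coset_eq_iff assms yF by simp
  qed
  then have "(\<Union>y\<in>H +>\<^bsub>F\<^esub> x. H +>\<^bsub>F\<^esub> (c \<odot>\<^bsub>F\<^esub> y)) = (\<Union>y\<in>H +>\<^bsub>F\<^esub> x. H +>\<^bsub>F\<^esub> (c \<odot>\<^bsub>F\<^esub> x))"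
    by (rule SUP_cong[OF refl])
  moreover have "H +>\<^bsub>F\<^esub> x \<noteq> {}" using assms a_rcos_self by blast
  ultimately show ?thesis by (simp add: Q_def)
qed

lemma Q_module: "module R Q"
proof -
  have add: "X \<oplus>\<^bsub>Q\<^esub> Y \<in> carrier Q" if "X \<in> carrier Q" "Y \<in> carrier Q" for X Y
    using that by (auto simp: Q_carrier Q_add)
  have "abelian_group Q"
  proof (rule abelian_groupI)
    fix X assume "X \<in> carrier Q"
    then obtain x where x: "x \<in> carrier F" "X = H +>\<^bsub>F\<^esub> x" by (auto simp: Q_carrier)
    have "(H +>\<^bsub>F\<^esub> \<ominus>\<^bsub>F\<^esub> x) \<oplus>\<^bsub>Q\<^esub> X = \<zero>\<^bsub>Q\<^esub>"
      unfolding x(2) using Q_add[of "\<ominus>\<^bsub>F\<^esub> x" x] x(1) by (simp add: Q_zero M.l_neg)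
    then show "\<exists>Y\<in>carrier Q. Y \<oplus>\<^bsub>Q\<^esub> X = \<zero>\<^bsub>Q\<^esub>" using x(1) by (auto simp: Q_carrier)
    show "\<zero>\<^bsub>Q\<^esub> \<oplus>\<^bsub>Q\<^esub> X = X"
      unfolding x(2) Q_zero using Q_add[of "\<zero>\<^bsub>F\<^esub>" x] x(1) by simp
    fix Y assume "Y \<in> carrier Q"
    then obtain y where y: "y \<in> carrier F" "Y = H +>\<^bsub>F\<^esub> y" by (auto simp: Q_carrier)
    show "X \<oplus>\<^bsub>Q\<^esub> Y = Y \<oplus>\<^bsub>Q\<^esub> X"
      unfolding x(2) y(2) using x(1) y(1) by (simp add: Q_add M.a_comm)
    fix Z assume "Z \<in> carrier Q"
    then obtain z where z: "z \<in> carrier F" "Z = H +>\<^bsub>F\<^esub> z" by (auto simp: Q_carrier)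
    show "X \<oplus>\<^bsub>Q\<^esub> Y \<oplus>\<^bsub>Q\<^esub> Z = X \<oplus>\<^bsub>Q\<^esub> (Y \<oplus>\<^bsub>Q\<^esub> Z)"
      unfolding x(2) y(2) z(2) using x(1) y(1) z(1) by (simp add: Q_add M.a_assoc)
  next
    show "\<zero>\<^bsub>Q\<^esub> \<in> carrier Q" unfolding Q_zero by (auto simp: Q_carrier)
  qed (rule add)
  then show ?thesis
    by (rule moduleI[OF R.is_cring])
      (auto simp: Q_carrier Q_smult Q_add smult_l_distr smult_r_distr smult_assoc1)
qed

end

section \<open>Bilinear maps and the universal property of the tensor product\<close>

definition bilinear where
  "bilinear R M N P f \<longleftrightarrow>
    (\<forall>m\<in>carrier M. f m \<in> linear_maps R N P) \<and> (\<forall>n\<in>carrier N. (\<lambda>m. f m n) \<in> linear_maps R M P)"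

lemma bilinearI:
  assumes "\<And>m. m \<in> carrier M \<Longrightarrow> (\<lambda>n. f m n) \<in> linear_maps R N P"
    and "\<And>n. n \<in> carrier N \<Longrightarrow> (\<lambda>m. f m n) \<in> linear_maps R M P"
  shows "bilinear R M N P f"
  using assms by (auto simp: bilinear_def)

lemma bilinearD:
  assumes "bilinear R M N P f"
  shows "m \<in> carrier M \<Longrightarrow> (\<lambda>n. f m n) \<in> linear_maps R N P"
    and "n \<in> carrier N \<Longrightarrow> (\<lambda>m. f m n) \<in> linear_maps R M P"
    and "\<lbrakk>m \<in> carrier M; n \<in> carrier N\<rbrakk> \<Longrightarrow> f m n \<in> carrier P"
  using assms by (auto simp: bilinear_def dest: linear_mapsD(1))

locale tensor_product = M: module R M + N: module R N
  for R :: "('k, 'c) ring_scheme"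
    and M :: "('k, 'm, 'd) module_scheme" and N :: "('k, 'n, 'e) module_scheme"
begin

abbreviation "F \<equiv> free_module R (carrier M \<times> carrier N)"
abbreviation "H \<equiv> tensor_kernel R M N"

sublocale F: module R F
  by (rule M.R.free_module_module)

lemma gen_closed: "\<lbrakk>m \<in> carrier M; n \<in> carrier N\<rbrakk> \<Longrightarrow> free_gen R (m, n) \<in> carrier F"
  by (simp add: M.R.free_gen_closed)

lemma relations_closed: "tensor_relations R M N \<subseteq> carrier F"
  by (auto simp: tensor_relations_def Let_def gen_closed intro!: F.M.minus_closed F.M.a_closed)

text \<open>An intersection of submodules is a submodule once the family is nonempty; the full free
  module is a member because it contains all relations.\<close>

lemma kernel_submodule: "submodule H R F"
proof -
  let ?K = "{H. submodule H R F \<and> tensor_relations R M N \<subseteq> H}"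
  have "carrier F \<in> ?K" using F.carrier_is_submodule relations_closed by simp
  moreover have "H = \<Inter>?K" by (simp add: tensor_kernel_def)
  ultimately show ?thesis
    by (intro F.submoduleI)
      (auto dest: subgroup.one_closed[OF submodule.axioms(1)] F.submoduleE(3,4) intro: F.submoduleE(5))
qed

lemma relations_kernel: "tensor_relations R M N \<subseteq> H"
  by (auto simp: tensor_kernel_def)

lemma kernel_least: "\<lbrakk>submodule K R F; tensor_relations R M N \<subseteq> K\<rbrakk> \<Longrightarrow> H \<subseteq> K"
  by (auto simp: tensor_kernel_def)

sublocale quotient: quotient_module R F H
  by (rule quotient_module.intro[OF F.module_axioms kernel_submodule])

lemma tensor_eq: "tensor R M N = quotient.Q"
  by (simp add: tensor_def quotient.Q_def Let_def)

lemma tensor_module: "module R (tensor R M N)"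
  unfolding tensor_eq by (rule quotient.Q_module)

sublocale tensor: module R "tensor R M N"
  by (rule tensor_module)

lemma pure_eq: "pure_tensor R M N m n = H +>\<^bsub>F\<^esub> free_gen R (m, n)"
  by (simp add: pure_tensor_def)

lemma pure_closed:
  "\<lbrakk>m \<in> carrier M; n \<in> carrier N\<rbrakk> \<Longrightarrow> pure_tensor R M N m n \<in> carrier (tensor R M N)"
  by (auto simp: pure_eq tensor_eq quotient.Q_carrier gen_closed)

lemma pure_bilinear: "bilinear R M N (tensor R M N) (pure_tensor R M N)"
proof (intro bilinearI linear_mapsI)
  fix m n m' assume c: "m \<in> carrier M" "n \<in> carrier N" "m' \<in> carrier M"
  have "free_gen R (m \<oplus>\<^bsub>M\<^esub> m', n) \<ominus>\<^bsub>F\<^esub> (free_gen R (m, n) \<oplus>\<^bsub>F\<^esub> free_gen R (m', n)) \<in> tensor_relations R M N"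
    unfolding tensor_relations_def Let_def using c by blast
  then show "pure_tensor R M N (m \<oplus>\<^bsub>M\<^esub> m') n =
      pure_tensor R M N m n \<oplus>\<^bsub>tensor R M N\<^esub> pure_tensor R M N m' n"
    unfolding pure_eq tensor_eq using c relations_kernel
    by (auto simp: quotient.Q_add gen_closed quotient.coset_eq_iff)
next
  fix m n n' assume c: "m \<in> carrier M" "n \<in> carrier N" "n' \<in> carrier N"
  have "free_gen R (m, n \<oplus>\<^bsub>N\<^esub> n') \<ominus>\<^bsub>F\<^esub> (free_gen R (m, n) \<oplus>\<^bsub>F\<^esub> free_gen R (m, n')) \<in> tensor_relations R M N"
    unfolding tensor_relations_def Let_def using c by blast
  then show "pure_tensor R M N m (n \<oplus>\<^bsub>N\<^esub> n') =
      pure_tensor R M N m n \<oplus>\<^bsub>tensor R M N\<^esub> pure_tensor R M N m n'"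
    unfolding pure_eq tensor_eq using c relations_kernel
    by (auto simp: quotient.Q_add gen_closed quotient.coset_eq_iff)
next
  fix c m n assume c: "c \<in> carrier R" "m \<in> carrier M" "n \<in> carrier N"
  have "free_gen R (m, c \<odot>\<^bsub>N\<^esub> n) \<ominus>\<^bsub>F\<^esub> c \<odot>\<^bsub>F\<^esub> free_gen R (m, n) \<in> tensor_relations R M N"
    unfolding tensor_relations_def Let_def using c by blast
  then show "pure_tensor R M N m (c \<odot>\<^bsub>N\<^esub> n) = c \<odot>\<^bsub>tensor R M N\<^esub> pure_tensor R M N m n"
    unfolding pure_eq tensor_eq using c relations_kernel
    by (auto simp: quotient.Q_smult gen_closed quotient.coset_eq_iff)
  have "free_gen R (c \<odot>\<^bsub>M\<^esub> m, n) \<ominus>\<^bsub>F\<^esub> c \<odot>\<^bsub>F\<^esub> free_gen R (m, n) \<in> tensor_relations R M N"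
    unfolding tensor_relations_def Let_def using c by blast
  then show "pure_tensor R M N (c \<odot>\<^bsub>M\<^esub> m) n = c \<odot>\<^bsub>tensor R M N\<^esub> pure_tensor R M N m n"
    unfolding pure_eq tensor_eq using c relations_kernel
    by (auto simp: quotient.Q_smult gen_closed quotient.coset_eq_iff)
qed (simp_all add: pure_closed)

text \<open>Two cases suffice: zero is the pure tensor of zeros, and a scalar multiple of a pure
  tensor is pure because the scalar can be absorbed into the left factor.\<close>

lemma tensor_induct [consumes 1, case_names pure add]:
  assumes u: "u \<in> carrier (tensor R M N)"
    and pure: "\<And>m n. \<lbrakk>m \<in> carrier M; n \<in> carrier N\<rbrakk> \<Longrightarrow> P (pure_tensor R M N m n)"
    and add: "\<And>u v. \<lbrakk>u \<in> carrier (tensor R M N); v \<in> carrier (tensor R M N); P u; P v\<rbrakk>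
      \<Longrightarrow> P (u \<oplus>\<^bsub>tensor R M N\<^esub> v)"
  shows "P u"
proof -
  note pb = bilinearD[OF pure_bilinear]
  have smult: "c \<odot>\<^bsub>tensor R M N\<^esub> pure_tensor R M N m n = pure_tensor R M N (c \<odot>\<^bsub>M\<^esub> m) n"
    if "c \<in> carrier R" "m \<in> carrier M" "n \<in> carrier N" for c m n
    using linear_mapsD(3)[OF pb(2)] that by metis
  have zero: "pure_tensor R M N \<zero>\<^bsub>M\<^esub> \<zero>\<^bsub>N\<^esub> = \<zero>\<^bsub>tensor R M N\<^esub>"
    using linear_maps_zero[OF N.module_axioms tensor_module pb(1)] by simp
  obtain g where g: "g \<in> carrier F" "u = H +>\<^bsub>F\<^esub> g"
    using u by (auto simp: tensor_eq quotient.Q_carrier)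
  from g(1) have "P (H +>\<^bsub>F\<^esub> g)"
  proof (induction g rule: M.R.free_module_induct)
    case zero
    then show ?case
      using pure[of "\<zero>\<^bsub>M\<^esub>" "\<zero>\<^bsub>N\<^esub>"] \<open>pure_tensor R M N \<zero>\<^bsub>M\<^esub> \<zero>\<^bsub>N\<^esub> = _\<close>
      by (simp add: tensor_eq quotient.Q_zero)
  next
    case (add c x g)
    obtain m n where x: "x = (m, n)" "m \<in> carrier M" "n \<in> carrier N" using add(2) by auto
    have "H +>\<^bsub>F\<^esub> (c \<odot>\<^bsub>F\<^esub> free_gen R x \<oplus>\<^bsub>F\<^esub> g) =
        c \<odot>\<^bsub>tensor R M N\<^esub> pure_tensor R M N m n \<oplus>\<^bsub>tensor R M N\<^esub> (H +>\<^bsub>F\<^esub> g)"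
      using add(1,3) x by (simp add: tensor_eq pure_eq gen_closed quotient.Q_add quotient.Q_smult)
    also have "P \<dots>"
      unfolding smult[OF add(1) x(2,3)]
    proof (rule assms(3))
      show "H +>\<^bsub>F\<^esub> g \<in> carrier (tensor R M N)"
        using add(3) by (auto simp: tensor_eq quotient.Q_carrier)
    qed (use add x in \<open>auto simp: pure_closed pure\<close>)
    finally show ?case .
  qed
  then show ?thesis using g(2) by simp
qed

text \<open>The bilinear map is extended linearly to the free module; the extension vanishes on the
  relations, hence on the kernel, and descends to cosets.\<close>

lemma tensor_lift_exists:
  assumes P: "module R P" and f: "bilinear R M N P f"
  obtains \<phi> where "\<phi> \<in> linear_maps R (tensor R M N) P"
    "\<And>m n. \<lbrakk>m \<in> carrier M; n \<in> carrier N\<rbrakk> \<Longrightarrow> \<phi> (pure_tensor R M N m n) = f m n"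
proof -
  interpret P: module R P by fact
  note fD = bilinearD[OF f]
  have "(\<lambda>(m, n). f m n) \<in> carrier M \<times> carrier N \<rightarrow> carrier P" using fD(3) by auto
  then obtain \<psi> where \<psi>: "\<psi> \<in> linear_maps R F P"
    and gen: "\<And>x. x \<in> carrier M \<times> carrier N \<Longrightarrow> \<psi> (free_gen R x) = (case x of (m, n) \<Rightarrow> f m n)"
    by (rule free_module_lift_exists[OF P]) blast
  note l = linear_mapsD[OF \<psi>]
  have minus: "\<psi> (x \<ominus>\<^bsub>F\<^esub> y) = \<psi> x \<ominus>\<^bsub>P\<^esub> \<psi> y" if "x \<in> carrier F" "y \<in> carrier F" for x y
    using that linear_maps_minus[OF F.module_axioms P \<psi>] by (simp add: a_minus_def l)
  have eq0: "x \<ominus>\<^bsub>P\<^esub> x = \<zero>\<^bsub>P\<^esub>" if "x \<in> carrier P" for x using that by (simp add: a_minus_def P.M.r_neg)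
  \<comment> \<open>The kernel of \<open>\<psi>\<close> is a submodule, so by minimality of
    \<open>H\<close> it is enough to check the four families of relations; each reduces to
    additivity or homogeneity of \<open>f\<close> in one variable.\<close>
  have kernel: "H \<subseteq> {x \<in> carrier F. \<psi> x = \<zero>\<^bsub>P\<^esub>}"
  proof (rule kernel_least[OF linear_maps_kernel_submodule[OF F.module_axioms P \<psi>]])
    show "tensor_relations R M N \<subseteq> {x \<in> carrier F. \<psi> x = \<zero>\<^bsub>P\<^esub>}"
      unfolding tensor_relations_def Let_def
      by (auto simp: gen_closed minus l gen eq0 fD(3) linear_mapsD[OF fD(1)] linear_mapsD[OF fD(2)])
  qed
  have ker: "\<psi> x = \<psi> y" if "x \<in> carrier F" "y \<in> carrier F" "x \<ominus>\<^bsub>F\<^esub> y \<in> H" for x y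
  proof -
    have "\<psi> x \<ominus>\<^bsub>P\<^esub> \<psi> y = \<zero>\<^bsub>P\<^esub>" using that minus[OF that(1,2)] kernel by auto
    then have "\<ominus>\<^bsub>P\<^esub> (\<ominus>\<^bsub>P\<^esub> \<psi> y) = \<psi> x"
      using l(1) that by (intro P.M.minus_equality) (simp_all add: a_minus_def)
    then show ?thesis using l(1) that by simp
  qed
  \<comment> \<open>The descended map evaluates \<open>\<psi>\<close> at an arbitrary
    representative; \<open>ker\<close> makes the choice irrelevant.\<close>
  define \<phi> where "\<phi> u = \<psi> (SOME x. x \<in> carrier F \<and> u = H +>\<^bsub>F\<^esub> x)" for u
  have \<phi>: "\<phi> (H +>\<^bsub>F\<^esub> x) = \<psi> x" if x: "x \<in> carrier F" for x
  proof -
    let ?y = "SOME y. y \<in> carrier F \<and> H +>\<^bsub>F\<^esub> x = H +>\<^bsub>F\<^esub> y"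
    have "?y \<in> carrier F \<and> H +>\<^bsub>F\<^esub> x = H +>\<^bsub>F\<^esub> ?y" by (rule someI[of _ x]) (simp add: x)
    then show ?thesis
      unfolding \<phi>_def using ker[of x ?y] quotient.coset_eq_iff[of x ?y] x by simp
  qed
  have "\<phi> \<in> linear_maps R (tensor R M N) P"
    by (rule linear_mapsI)
      (auto simp: tensor_eq quotient.Q_carrier quotient.Q_add quotient.Q_smult \<phi> l)
  moreover have "\<phi> (pure_tensor R M N m n) = f m n" if "m \<in> carrier M" "n \<in> carrier N" for m n
    using that by (simp add: pure_eq \<phi> gen_closed gen)
  ultimately show thesis using that by blast
qed

text \<open>The uniqueness half of the universal property: pure tensors generate additively.\<close>

lemma linear_maps_tensor_eqI:
  assumes "\<phi> \<in> linear_maps R (tensor R M N) P" "\<psi> \<in> linear_maps R (tensor R M N) P"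
    and "\<And>m n. \<lbrakk>m \<in> carrier M; n \<in> carrier N\<rbrakk> \<Longrightarrow> \<phi> (pure_tensor R M N m n) = \<psi> (pure_tensor R M N m n)"
    and u: "u \<in> carrier (tensor R M N)"
  shows "\<phi> u = \<psi> u"
  using u
  by (induction u rule: tensor_induct)
    (simp_all add: assms(3) linear_mapsD[OF assms(1)] linear_mapsD[OF assms(2)])

text \<open>Justifies the definite description in \<open>tensor_lift\<close>. Existence is obtained
  by restricting any induced map to the carrier; extensionality upgrades uniqueness on the carrier
  to equality of functions.\<close>

lemma tensor_lift:
  assumes P: "module R P" and f: "bilinear R M N P f"
  shows "tensor_lift R M N P f \<in> linear_maps R (tensor R M N) P"
    and "\<lbrakk>m \<in> carrier M; n \<in> carrier N\<rbrakk> \<Longrightarrow> tensor_lift R M N P f (pure_tensor R M N m n) = f m n"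
proof -
  let ?Q = "\<lambda>\<phi>. \<phi> \<in> linear_maps R (tensor R M N) P \<inter> extensional (carrier (tensor R M N)) \<and>
      (\<forall>m\<in>carrier M. \<forall>n\<in>carrier N. \<phi> (pure_tensor R M N m n) = f m n)"
  obtain \<phi> where \<phi>: "\<phi> \<in> linear_maps R (tensor R M N) P"
    "\<And>m n. \<lbrakk>m \<in> carrier M; n \<in> carrier N\<rbrakk> \<Longrightarrow> \<phi> (pure_tensor R M N m n) = f m n"
    using tensor_lift_exists[OF P f] by blast
  have "?Q (restrict \<phi> (carrier (tensor R M N)))"
    using linear_maps_restrict[OF tensor_module \<phi>(1)] \<phi>(2) pure_closed by simp
  moreover have "\<psi> = \<psi>'" if "?Q \<psi>" "?Q \<psi>'" for \<psi> \<psi>'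
    by (rule extensionalityI[of _ "carrier (tensor R M N)"])
      (use that linear_maps_tensor_eqI[of \<psi> P \<psi>'] in auto)
  ultimately have "\<exists>!\<phi>. ?Q \<phi>" by blast
  then have "?Q (tensor_lift R M N P f)"
    unfolding tensor_lift_def by (rule theI')
  then show "tensor_lift R M N P f \<in> linear_maps R (tensor R M N) P"
    and "\<lbrakk>m \<in> carrier M; n \<in> carrier N\<rbrakk> \<Longrightarrow> tensor_lift R M N P f (pure_tensor R M N m n) = f m n"
    by auto
qed

end

text \<open>The description behind \<open>tensor_lift\<close> sees the map only on the two carriers,
  so both sides have the same candidates. This is the rule for rewriting under a Sweedler
  sum.\<close>

lemma tensor_lift_cong:
  assumes "\<And>m n. \<lbrakk>m \<in> carrier M; n \<in> carrier N\<rbrakk> \<Longrightarrow> f m n = g m n"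
  shows "tensor_lift R M N P f u = tensor_lift R M N P g u"
proof -
  have "(\<forall>m\<in>carrier M. \<forall>n\<in>carrier N. \<phi> (pure_tensor R M N m n) = f m n) \<longleftrightarrow>
      (\<forall>m\<in>carrier M. \<forall>n\<in>carrier N. \<phi> (pure_tensor R M N m n) = g m n)" for \<phi>
    using assms by auto
  then show ?thesis by (simp add: tensor_lift_def)
qed

lemma linear_maps_id: "(\<lambda>x. x) \<in> linear_maps R M M"
  by (simp add: linear_maps_def)

section \<open>Linearity rules for nested Sweedler expressions\<close>

context
  fixes R :: "('k, 'c) ring_scheme"
    and M :: "('k, 'm, 'd) module_scheme" and N :: "('k, 'n, 'e) module_scheme"
  assumes M: "module R M" and N: "module R N"
begin

interpretation tensor_product R M N
  by (rule tensor_product.intro[OF M N])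

lemma module_tensor: "module R (tensor R M N)"
  by (rule tensor_module)

lemma pure_tensor_closed:
  "\<lbrakk>m \<in> carrier M; n \<in> carrier N\<rbrakk> \<Longrightarrow> pure_tensor R M N m n \<in> carrier (tensor R M N)"
  by (rule pure_closed)

lemma linear_pure_tensor_left:
  "\<lbrakk>f \<in> linear_maps R X M; n \<in> carrier N\<rbrakk>
    \<Longrightarrow> (\<lambda>x. pure_tensor R M N (f x) n) \<in> linear_maps R X (tensor R M N)"
  by (rule linear_maps_comp[OF bilinearD(2)[OF pure_bilinear]])

lemma linear_pure_tensor_right:
  "\<lbrakk>f \<in> linear_maps R X N; m \<in> carrier M\<rbrakk>
    \<Longrightarrow> (\<lambda>x. pure_tensor R M N m (f x)) \<in> linear_maps R X (tensor R M N)"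
  by (rule linear_maps_comp[OF bilinearD(1)[OF pure_bilinear]])

context
  fixes P :: "('k, 'p, 'f) module_scheme"
  assumes P: "module R P"
begin

lemma tensor_lift_pure:
  "\<lbrakk>bilinear R M N P f; m \<in> carrier M; n \<in> carrier N\<rbrakk>
    \<Longrightarrow> tensor_lift R M N P f (pure_tensor R M N m n) = f m n"
  by (rule tensor_lift(2)[OF P])

lemma linear_tensor_lift:
  "\<lbrakk>bilinear R M N P f; g \<in> linear_maps R X (tensor R M N)\<rbrakk>
    \<Longrightarrow> (\<lambda>x. tensor_lift R M N P f (g x)) \<in> linear_maps R X P"
  by (rule linear_maps_comp[OF tensor_lift(1)[OF P]])

lemma tensor_lift_closed:
  "\<lbrakk>bilinear R M N P f; u \<in> carrier (tensor R M N)\<rbrakk> \<Longrightarrow> tensor_lift R M N P f u \<in> carrier P"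
  by (rule linear_mapsD(1)[OF tensor_lift(1)[OF P]])

text \<open>In a nested Sweedler sum the outer variable occurs as a parameter of the inner summand.
  Linearity in that parameter is checked by induction on \<open>u\<close>, starting from pure
  tensors.\<close>

lemma linear_tensor_lift_fun:
  assumes f: "\<And>x. x \<in> carrier X \<Longrightarrow> bilinear R M N P (\<lambda>m n. f x m n)"
    and lin: "\<And>m n. \<lbrakk>m \<in> carrier M; n \<in> carrier N\<rbrakk> \<Longrightarrow> (\<lambda>x. f x m n) \<in> linear_maps R X P"
    and X: "module R X" and u: "u \<in> carrier (tensor R M N)"
  shows "(\<lambda>x. tensor_lift R M N P (\<lambda>m n. f x m n) u) \<in> linear_maps R X P"
proof -
  interpret P: module R P by (rule P)
  interpret X: module R X by (rule X)
  have f': "bilinear R M N P (f x)" if "x \<in> carrier X" for x using f[OF that] by simp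
  note l = linear_mapsD[OF tensor_lift(1)[OF P f']] and p = tensor_lift(2)[OF P f']
  note ml = linear_mapsD[OF lin]
  have "tensor_lift R M N P (f (x \<oplus>\<^bsub>X\<^esub> y)) u =
      tensor_lift R M N P (f x) u \<oplus>\<^bsub>P\<^esub> tensor_lift R M N P (f y) u"
    if xy: "x \<in> carrier X" "y \<in> carrier X" for x y
    using u
  proof (induction u rule: tensor_induct)
    case (pure m n)
    then show ?case using xy by (simp add: p ml)
  next
    case (add v w)
    then show ?case using xy by (simp add: l P.M.a_ac)
  qed
  moreover have "tensor_lift R M N P (f (c \<odot>\<^bsub>X\<^esub> x)) u = c \<odot>\<^bsub>P\<^esub> tensor_lift R M N P (f x) u"
    if cx: "c \<in> carrier R" "x \<in> carrier X" for c x
    using u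
  proof (induction u rule: tensor_induct)
    case (pure m n)
    then show ?case using cx by (simp add: p ml)
  next
    case (add v w)
    then show ?case using cx by (simp add: l P.smult_r_distr)
  qed
  ultimately show ?thesis
    using tensor_lift_closed[OF f' u] by (intro linear_mapsI) simp_all
qed

lemma bilinear_comp:
  assumes "g \<in> linear_maps R P Q" "bilinear R M N P f"
  shows "bilinear R M N Q (\<lambda>m n. g (f m n))"
  by (intro bilinearI linear_maps_comp[OF assms(1)] bilinearD[OF assms(2)])

text \<open>Linear maps commute with Sweedler sums: both sides are linear in \<open>u\<close> and
  agree on pure tensors.\<close>

lemma linear_map_tensor_lift:
  assumes Q: "module R Q" and g: "g \<in> linear_maps R P Q" and f: "bilinear R M N P f"
    and u: "u \<in> carrier (tensor R M N)"
  shows "g (tensor_lift R M N P f u) = tensor_lift R M N Q (\<lambda>m n. g (f m n)) u"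
  by (rule linear_maps_tensor_eqI[OF linear_maps_comp[OF g tensor_lift(1)[OF P f]]
        tensor_lift(1)[OF Q bilinear_comp[OF g f]] _ u])
    (simp add: tensor_lift(2)[OF P f] tensor_lift(2)[OF Q bilinear_comp[OF g f]])

end

end

text \<open>Each rule descends through one constructor of an expression, so repeated resolution
  settles linearity and membership by the shape of the term. Later collections add the operations of
  \<open>T\<close>, \<open>A\<close> and the smash product.\<close>

lemmas lin_rules = bilinearI module_tensor pure_tensor_closed linear_maps_id
  linear_pure_tensor_left linear_pure_tensor_right tensor_lift_closed
  linear_tensor_lift linear_tensor_lift_fun

text \<open>The common source of both coassociativity rules: the functional that \<open>f\<close>
  induces on the triple tensor product is applied to the two sides of \<open>eq\<close>. For the
  coproduct all modules are T; for the coaction, \<open>\<gamma>\<close> is the coaction and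
  \<open>\<delta>\<close> the coproduct.\<close>

lemma trilinear_reassociate:
  fixes f :: "'m \<Rightarrow> 'n \<Rightarrow> 'p \<Rightarrow> 'q"
  assumes M: "module R M" and N: "module R N" and P: "module R P" and Q: "module R Q"
    and M': "module R M'" and N': "module R N'"
    and f: "\<And>m. m \<in> carrier M \<Longrightarrow> bilinear R N P Q (\<lambda>n p. f m n p)"
    and f1: "\<And>n p. \<lbrakk>n \<in> carrier N; p \<in> carrier P\<rbrakk> \<Longrightarrow> (\<lambda>m. f m n p) \<in> linear_maps R M Q"
    and \<gamma>: "\<gamma> \<in> linear_maps R M' (tensor R M N)" and \<delta>: "\<delta> \<in> linear_maps R N' (tensor R N P)"
    and u: "u \<in> carrier (tensor R M' P)" and v: "v \<in> carrier (tensor R M N')"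
    and eq: "tensor_assoc R M N P (tensor_map R M' P (tensor R M N) P \<gamma> (\<lambda>x. x) u) =
      tensor_map R M N' M (tensor R N P) (\<lambda>x. x) \<delta> v"
  shows "tensor_lift R M' P Q (\<lambda>m' p. tensor_lift R M N Q (\<lambda>m n. f m n p) (\<gamma> m')) u =
    tensor_lift R M N' Q (\<lambda>m n'. tensor_lift R N P Q (\<lambda>n p. f m n p) (\<delta> n')) v"
proof -
  have f2: "(\<lambda>n. f m n p) \<in> linear_maps R N Q" if "m \<in> carrier M" "p \<in> carrier P" for m p
    using bilinearD(2)[OF f] that .
  have f3: "(\<lambda>p. f m n p) \<in> linear_maps R P Q" if "m \<in> carrier M" "n \<in> carrier N" for m n
    using bilinearD(1)[OF f] that .
  have \<gamma>': "\<gamma> x \<in> carrier (tensor R M N)" if "x \<in> carrier M'" for x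
    using linear_mapsD(1)[OF \<gamma>] that .
  have \<delta>': "\<delta> x \<in> carrier (tensor R N P)" if "x \<in> carrier N'" for x
    using linear_mapsD(1)[OF \<delta>] that .
  note lin = lin_rules M N P Q M' N' f1 f2 f3 \<gamma> \<delta> \<gamma>' \<delta>'
  let ?NP = "tensor R N P"
  let ?MNP = "tensor R M ?NP"
  let ?MN = "tensor R M N"
  \<comment> \<open>This is \<open>f\<close> as a linear map on the right-bracketed triple tensor
    product, the common target of both sides of \<open>eq\<close>.\<close>
  define \<Phi> where "\<Phi> = tensor_lift R M ?NP Q (\<lambda>m w. tensor_lift R N P Q (\<lambda>n p. f m n p) w)"
  have bil: "bilinear R M ?NP Q (\<lambda>m w. tensor_lift R N P Q (\<lambda>n p. f m n p) w)"
    by (rule lin | assumption)+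
  then have \<Phi>: "\<Phi> \<in> linear_maps R ?MNP Q"
    unfolding \<Phi>_def by - (rule tensor_product.tensor_lift(1) tensor_product.intro Q lin | assumption)+
  have \<Phi>_pure: "\<Phi> (pure_tensor R M ?NP m w) = tensor_lift R N P Q (\<lambda>n p. f m n p) w"
    if "m \<in> carrier M" "w \<in> carrier ?NP" for m w
    unfolding \<Phi>_def by (rule tensor_lift_pure[OF M module_tensor[OF N P] Q bil that])
  define \<alpha> where "\<alpha> = tensor_assoc R M N P"
  have bil\<alpha>: "bilinear R ?MN P ?MNP
      (\<lambda>w p. tensor_lift R M N ?MNP (\<lambda>m n. pure_tensor R M ?NP m (pure_tensor R N P n p)) w)"
    by (rule lin | assumption)+
  have \<alpha>: "\<alpha> \<in> linear_maps R (tensor R ?MN P) ?MNP"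
    unfolding \<alpha>_def tensor_assoc_def by (rule lin | assumption)+
  have \<alpha>_pure: "\<alpha> (pure_tensor R ?MN P w p) =
      tensor_lift R M N ?MNP (\<lambda>m n. pure_tensor R M ?NP m (pure_tensor R N P n p)) w"
    if "w \<in> carrier ?MN" "p \<in> carrier P" for w p
    unfolding \<alpha>_def tensor_assoc_def by (rule tensor_lift_pure[OF _ _ _ bil\<alpha> that]) (rule lin)+
  \<comment> \<open>On the left-bracketed side the associativity map intervenes:
    \<open>\<Phi>\<close> composed with \<open>\<alpha>\<close> is pulled through the outer sum, and
    then \<open>\<Phi>\<close> through the inner one.\<close>
  have "\<Phi> (\<alpha> (tensor_map R M' P ?MN P \<gamma> (\<lambda>x. x) u)) =
      tensor_lift R M' P Q (\<lambda>m' p. \<Phi> (\<alpha> (pure_tensor R ?MN P (\<gamma> m') p))) u"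
    unfolding tensor_map_def
    by (rule linear_map_tensor_lift[where g="\<lambda>x. \<Phi> (\<alpha> x)"])
      (rule lin u linear_maps_comp[OF \<Phi> \<alpha>] | assumption)+
  also have "\<dots> = tensor_lift R M' P Q (\<lambda>m' p. tensor_lift R M N Q (\<lambda>m n. f m n p) (\<gamma> m')) u"
  proof (rule tensor_lift_cong)
    fix m' p assume c: "m' \<in> carrier M'" "p \<in> carrier P"
    have "\<Phi> (\<alpha> (pure_tensor R ?MN P (\<gamma> m') p)) =
        tensor_lift R M N Q (\<lambda>m n. \<Phi> (pure_tensor R M ?NP m (pure_tensor R N P n p))) (\<gamma> m')"
      unfolding \<alpha>_pure[OF \<gamma>'[OF c(1)] c(2)]
      by (rule linear_map_tensor_lift) (rule lin c \<Phi> | assumption)+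
    also have "\<dots> = tensor_lift R M N Q (\<lambda>m n. f m n p) (\<gamma> m')"
      by (rule tensor_lift_cong)
        (simp add: \<Phi>_pure pure_tensor_closed[OF N P] tensor_lift_pure[OF N P Q f] c(2))
    finally show "\<Phi> (\<alpha> (pure_tensor R ?MN P (\<gamma> m') p)) =
        tensor_lift R M N Q (\<lambda>m n. f m n p) (\<gamma> m')" .
  qed
  finally have 1: "\<Phi> (\<alpha> (tensor_map R M' P ?MN P \<gamma> (\<lambda>x. x) u)) = \<dots>" .
  \<comment> \<open>The other side is already right-bracketed, so \<open>\<Phi>\<close> applies
    directly.\<close>
  have "\<Phi> (tensor_map R M N' M ?NP (\<lambda>x. x) \<delta> v) =
      tensor_lift R M N' Q (\<lambda>m n'. \<Phi> (pure_tensor R M ?NP m (\<delta> n'))) v"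
    unfolding tensor_map_def
    by (rule linear_map_tensor_lift) (rule lin v \<Phi> | assumption)+
  also have "\<dots> = tensor_lift R M N' Q (\<lambda>m n'. tensor_lift R N P Q (\<lambda>n p. f m n p) (\<delta> n')) v"
    by (rule tensor_lift_cong) (simp add: \<Phi>_pure \<delta>')
  finally show ?thesis using 1 eq by (simp add: \<alpha>_def)
qed

section \<open>The tensor product of two algebras\<close>

lemma (in assoc_algebra) linear_mult_left:
  assumes "f \<in> linear_maps R X M" "y \<in> carrier M"
  shows "(\<lambda>x. f x \<otimes>\<^bsub>M\<^esub> y) \<in> linear_maps R X M"
  by (rule linear_mapsI) (simp_all add: linear_mapsD[OF assms(1)] assms(2) M.l_distr smult_mult_left)

lemma (in assoc_algebra) linear_mult_right:
  assumes "f \<in> linear_maps R X M" "y \<in> carrier M"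
  shows "(\<lambda>x. y \<otimes>\<^bsub>M\<^esub> f x) \<in> linear_maps R X M"
  by (rule linear_mapsI) (simp_all add: linear_mapsD[OF assms(1)] assms(2) M.r_distr smult_mult_right)

lemma (in module) linear_smult:
  assumes "f \<in> linear_maps R X M" "c \<in> carrier R"
  shows "(\<lambda>x. c \<odot>\<^bsub>M\<^esub> f x) \<in> linear_maps R X M"
  by (rule linear_mapsI)
    (simp_all add: linear_mapsD[OF assms(1)] assms(2) smult_r_distr R.m_comm flip: smult_assoc1)

text \<open>The map induced by the canonical bilinear map is the identity. Applied to a coproduct it
  expands the coproduct as a Sweedler sum of pure tensors.\<close>

lemma tensor_lift_pure_tensor_eq:
  assumes "module R M" "module R N" "u \<in> carrier (tensor R M N)"
  shows "tensor_lift R M N (tensor R M N) (\<lambda>m n. pure_tensor R M N m n) u = u"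
proof -
  interpret tensor_product R M N by (rule tensor_product.intro[OF assms(1,2)])
  note lin = lin_rules assms
  have bil: "bilinear R M N (tensor R M N) (\<lambda>m n. pure_tensor R M N m n)"
    by (rule lin | assumption)+
  show ?thesis
    by (rule linear_maps_tensor_eqI[OF tensor_lift(1)[OF tensor_module bil] linear_maps_id _ assms(3)])
      (rule tensor_lift(2)[OF tensor_module bil])
qed

text \<open>The codomain enters the definition only through its set of linear maps. Hence a tensor
  module may be exchanged for the tensor algebra or the smash product on the same module.\<close>

lemma tensor_lift_codomain_cong:
  "linear_maps R (tensor R M N) P = linear_maps R (tensor R M N) P' \<Longrightarrow>
    tensor_lift R M N P = tensor_lift R M N P'"
  by (simp add: tensor_lift_def fun_eq_iff)

lemma tensor_algebra_sel:
  "carrier (tensor_algebra R M N) = carrier (tensor R M N)"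
  "add (tensor_algebra R M N) = add (tensor R M N)"
  "zero (tensor_algebra R M N) = zero (tensor R M N)"
  "smult (tensor_algebra R M N) = smult (tensor R M N)"
  "\<one>\<^bsub>tensor_algebra R M N\<^esub> = pure_tensor R M N \<one>\<^bsub>M\<^esub> \<one>\<^bsub>N\<^esub>"
  by (simp_all add: tensor_algebra_def)

lemma linear_maps_tensor_algebra:
  "linear_maps R X (tensor_algebra R M N) = linear_maps R X (tensor R M N)"
  by (simp add: linear_maps_def tensor_algebra_sel)

text \<open>Transports the module structure to records that override only the product and the
  unit.\<close>

lemma module_cong:
  assumes "module R M" "carrier N = carrier M" "add N = add M" "zero N = zero M" "smult N = smult M"
  shows "module R N"
proof -
  interpret M: module R M by fact
  have "abelian_group N"
    by (rule abelian_groupI) (use assms M.M.add.l_inv_ex in \<open>auto simp: M.M.a_ac\<close>)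
  then show ?thesis
    by (rule moduleI[OF M.R.is_cring])
      (simp_all add: assms M.smult_l_distr M.smult_r_distr M.smult_assoc1)
qed

context
  fixes R :: "('k, 'c) ring_scheme"
    and M :: "('k, 'm, 'd) module_scheme" and N :: "('k, 'n, 'e) module_scheme"
  assumes MA: "assoc_algebra R M" and NA: "assoc_algebra R N"
begin

interpretation M: assoc_algebra R M by (rule MA)
interpretation N: assoc_algebra R N by (rule NA)

lemma tensor_algebra_module: "module R (tensor_algebra R M N)"
  by (rule module_cong[OF module_tensor[OF M.module_axioms N.module_axioms]])
    (simp_all add: tensor_algebra_sel)

private lemmas lin = lin_rules M.module_axioms N.module_axioms tensor_algebra_module
  M.linear_mult_left M.linear_mult_right N.linear_mult_left N.linear_mult_right
  M.M.m_closed N.M.m_closed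

lemma tensor_algebra_mult:
  "u \<otimes>\<^bsub>tensor_algebra R M N\<^esub> v = tensor_lift R M N (tensor R M N) (\<lambda>m n.
     tensor_lift R M N (tensor R M N) (\<lambda>m' n'. pure_tensor R M N (m \<otimes>\<^bsub>M\<^esub> m') (n \<otimes>\<^bsub>N\<^esub> n')) v) u"
  by (simp add: tensor_algebra_def)

lemma tensor_algebra_mult_linear:
  "u \<in> carrier (tensor_algebra R M N) \<Longrightarrow> (\<lambda>v. u \<otimes>\<^bsub>tensor_algebra R M N\<^esub> v) \<in> linear_maps R (tensor_algebra R M N) (tensor_algebra R M N)"
  "v \<in> carrier (tensor_algebra R M N) \<Longrightarrow> (\<lambda>u. u \<otimes>\<^bsub>tensor_algebra R M N\<^esub> v) \<in> linear_maps R (tensor_algebra R M N) (tensor_algebra R M N)"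
proof -
  have eq: "linear_maps R (tensor_algebra R M N) (tensor_algebra R M N) = linear_maps R (tensor R M N) (tensor R M N)"
    by (simp add: linear_maps_def tensor_algebra_sel)
  show "(\<lambda>v. u \<otimes>\<^bsub>tensor_algebra R M N\<^esub> v) \<in> linear_maps R (tensor_algebra R M N) (tensor_algebra R M N)" if "u \<in> carrier (tensor_algebra R M N)"
    using that unfolding tensor_algebra_mult tensor_algebra_sel eq by - (rule lin | assumption)+
  show "(\<lambda>u. u \<otimes>\<^bsub>tensor_algebra R M N\<^esub> v) \<in> linear_maps R (tensor_algebra R M N) (tensor_algebra R M N)" if "v \<in> carrier (tensor_algebra R M N)"
    using that unfolding tensor_algebra_mult tensor_algebra_sel eq by - (rule lin | assumption)+
qed

lemma tensor_algebra_mult_pure: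
  assumes "m \<in> carrier M" "n \<in> carrier N" "m' \<in> carrier M" "n' \<in> carrier N"
  shows "pure_tensor R M N m n \<otimes>\<^bsub>tensor_algebra R M N\<^esub> pure_tensor R M N m' n' = pure_tensor R M N (m \<otimes>\<^bsub>M\<^esub> m') (n \<otimes>\<^bsub>N\<^esub> n')"
proof -
  have "pure_tensor R M N m n \<otimes>\<^bsub>tensor_algebra R M N\<^esub> pure_tensor R M N m' n' =
      tensor_lift R M N (tensor R M N) (\<lambda>m' n'. pure_tensor R M N (m \<otimes>\<^bsub>M\<^esub> m') (n \<otimes>\<^bsub>N\<^esub> n')) (pure_tensor R M N m' n')"
    unfolding tensor_algebra_mult by (rule tensor_lift_pure) (rule lin assms | assumption)+
  also have "\<dots> = pure_tensor R M N (m \<otimes>\<^bsub>M\<^esub> m') (n \<otimes>\<^bsub>N\<^esub> n')"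
    by (rule tensor_lift_pure) (rule lin assms | assumption)+
  finally show ?thesis .
qed

text \<open>The product is bilinear, so each law reduces, by induction on one factor at a time, to
  pure tensors, where it holds componentwise.\<close>

theorem tensor_algebra_assoc_algebra: "assoc_algebra R (tensor_algebra R M N)"
proof -
  interpret MN: module R "tensor_algebra R M N" by (rule tensor_algebra_module)
  interpret tp: tensor_product R M N by (rule tensor_product.intro[OF M.module_axioms N.module_axioms])
  note l1 = tensor_algebra_mult_linear(1) and l2 = tensor_algebra_mult_linear(2)
  note simps = linear_mapsD[OF l1] linear_mapsD[OF l2] tensor_algebra_mult_pure
    tp.pure_closed[folded tensor_algebra_sel(1)]
  note induct = tp.tensor_induct[folded tensor_algebra_sel(1) tensor_algebra_sel(2),
      consumes 1, case_names pure add]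
  have assoc: "(u \<otimes>\<^bsub>tensor_algebra R M N\<^esub> v) \<otimes>\<^bsub>tensor_algebra R M N\<^esub> w = u \<otimes>\<^bsub>tensor_algebra R M N\<^esub> (v \<otimes>\<^bsub>tensor_algebra R M N\<^esub> w)"
    if u: "u \<in> carrier (tensor_algebra R M N)" and v: "v \<in> carrier (tensor_algebra R M N)" and w: "w \<in> carrier (tensor_algebra R M N)" for u v w
    using u
  proof (induction rule: induct)
    case pure1: (pure m n)
    show ?case using v
    proof (induction rule: induct)
      case pure2: (pure m' n')
      show ?case using w
      proof (induction rule: induct)
        case (pure m'' n'')
        then show ?case using pure1 pure2 by (simp add: simps M.m_assoc N.m_assoc)
      qed (use pure1 pure2 in \<open>simp add: simps\<close>)
    qed (use pure1 w in \<open>simp add: simps\<close>)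
  qed (use v w in \<open>simp add: simps\<close>)
  have one: "\<one>\<^bsub>tensor_algebra R M N\<^esub> \<in> carrier (tensor_algebra R M N)"
    by (simp add: tensor_algebra_sel tp.pure_closed)
  have one_l: "\<one>\<^bsub>tensor_algebra R M N\<^esub> \<otimes>\<^bsub>tensor_algebra R M N\<^esub> u = u" if "u \<in> carrier (tensor_algebra R M N)" for u
    using that
  proof (induction rule: induct)
    case (pure m n)
    then show ?case by (simp add: tensor_algebra_sel(5) simps)
  qed (simp add: one simps)
  have one_r: "u \<otimes>\<^bsub>tensor_algebra R M N\<^esub> \<one>\<^bsub>tensor_algebra R M N\<^esub> = u" if "u \<in> carrier (tensor_algebra R M N)" for u
    using that
  proof (induction rule: induct)
    case (pure m n)
    then show ?case by (simp add: tensor_algebra_sel(5) simps)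
  qed (simp add: one simps)
  have "ring (tensor_algebra R M N)"
    by (rule ringI[OF MN.abelian_group_axioms monoidI])
      (simp_all add: simps one one_l one_r assoc)
  then show ?thesis
    by (intro assoc_algebra.intro assoc_algebra_axioms.intro tensor_algebra_module) (simp_all add: simps)
qed

end

section \<open>The antipode is an anti-coalgebra map\<close>

context hopf_algebra
begin

abbreviation "TT \<equiv> tensor_algebra R T T"

abbreviation sweedler :: "('k, 'p, 'z) module_scheme \<Rightarrow> ('t \<Rightarrow> 't \<Rightarrow> 'p) \<Rightarrow> 't \<Rightarrow> 'p"
  where "sweedler P f t \<equiv> tensor_lift R T T P f (\<Delta> t)"

lemma comult_linear: "\<Delta> \<in> linear_maps R T (tensor R T T)"
  using comult_hom by (simp add: algebra_homs_def linear_maps_tensor_algebra)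

lemma comult_closed: "t \<in> carrier T \<Longrightarrow> \<Delta> t \<in> carrier (tensor R T T)"
  by (rule linear_mapsD(1)[OF comult_linear])

lemma comult_mult: "\<lbrakk>s \<in> carrier T; t \<in> carrier T\<rbrakk> \<Longrightarrow> \<Delta> (s \<otimes>\<^bsub>T\<^esub> t) = \<Delta> s \<otimes>\<^bsub>TT\<^esub> \<Delta> t"
  using comult_hom by (auto simp: algebra_homs_def ring_hom_def)

lemma comult_one: "\<Delta> \<one>\<^bsub>T\<^esub> = \<one>\<^bsub>TT\<^esub>"
  using comult_hom by (auto simp: algebra_homs_def ring_hom_def)

lemma counit_closed: "t \<in> carrier T \<Longrightarrow> \<epsilon> t \<in> carrier R"
  using counit_hom by (auto simp: algebra_homs_def ring_hom_def ground_algebra_def)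

lemma counit_one: "\<epsilon> \<one>\<^bsub>T\<^esub> = \<one>\<^bsub>R\<^esub>"
  using counit_hom by (auto simp: algebra_homs_def ring_hom_def ground_algebra_def)

lemma linear_counit:
  assumes "module R P" "f \<in> linear_maps R X T" "y \<in> carrier P"
  shows "(\<lambda>x. \<epsilon> (f x) \<odot>\<^bsub>P\<^esub> y) \<in> linear_maps R X P"
proof -
  interpret P: module R P by fact
  have \<epsilon>: "\<epsilon> \<in> linear_maps R T (ground_algebra R)" using counit_hom by (simp add: algebra_homs_def)
  note l = linear_mapsD[OF linear_maps_comp[OF \<epsilon> assms(2)], unfolded ground_algebra_def, simplified]
  show ?thesis
    by (rule linear_mapsI) (simp_all add: l assms(3) P.smult_l_distr P.smult_assoc1)
qed

lemma linear_comult: "f \<in> linear_maps R X T \<Longrightarrow> (\<lambda>x. \<Delta> (f x)) \<in> linear_maps R X (tensor R T T)"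
  by (rule linear_maps_comp[OF comult_linear])

lemma linear_antipode: "f \<in> linear_maps R X T \<Longrightarrow> (\<lambda>x. S (f x)) \<in> linear_maps R X T"
  by (rule linear_maps_comp[OF antipode_linear])

lemma antipode_closed: "t \<in> carrier T \<Longrightarrow> S t \<in> carrier T"
  by (rule linear_mapsD(1)[OF antipode_linear])

lemmas hopf_lin = lin_rules module_axioms linear_mult_left linear_mult_right linear_counit
  linear_comult linear_antipode antipode_closed comult_closed M.m_closed M.one_closed

section \<open>Sweedler calculus in T and uniqueness of convolution inverses\<close>

lemma sweedler_coassoc:
  assumes "module R P" "t \<in> carrier T"
    and "\<And>x. x \<in> carrier T \<Longrightarrow> bilinear R T T P (\<lambda>y z. f x y z)"
    and "\<And>y z. \<lbrakk>y \<in> carrier T; z \<in> carrier T\<rbrakk> \<Longrightarrow> (\<lambda>x. f x y z) \<in> linear_maps R T P"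
  shows "sweedler P (\<lambda>w z. sweedler P (\<lambda>x y. f x y z) w) t =
    sweedler P (\<lambda>x w. sweedler P (\<lambda>y z. f x y z) w) t"
  by (rule trilinear_reassociate)
    (rule assms coassoc[OF assms(2)] hopf_lin comult_linear | assumption)+

lemma sweedler_linear:
  assumes "module R P" "module R Q" "g \<in> linear_maps R P Q" "bilinear R T T P f" "t \<in> carrier T"
  shows "g (sweedler P f t) = sweedler Q (\<lambda>x y. g (f x y)) t"
  by (rule linear_map_tensor_lift) (rule assms hopf_lin)+

lemma comult_sweedler:
  "t \<in> carrier T \<Longrightarrow> sweedler (tensor R T T) (\<lambda>x y. pure_tensor R T T x y) t = \<Delta> t"
  by (rule tensor_lift_pure_tensor_eq[OF module_axioms module_axioms comult_closed])

text \<open>The antipode axiom evaluated at 1, whose coproduct is 1 \<otimes> 1.\<close>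

lemma antipode_one: "S \<one>\<^bsub>T\<^esub> = \<one>\<^bsub>T\<^esub>"
proof -
  have "S \<one>\<^bsub>T\<^esub> = sweedler T (\<lambda>x y. S x \<otimes>\<^bsub>T\<^esub> y) \<one>\<^bsub>T\<^esub>"
    unfolding comult_one tensor_algebra_sel(5)
    by (subst tensor_lift_pure, (rule hopf_lin | assumption)+) (simp add: antipode_closed)
  also have "\<dots> = \<one>\<^bsub>T\<^esub>" by (simp add: antipode_left counit_one)
  finally show ?thesis .
qed

text \<open>The usual monoid argument E = E * (D * G) = (E * D) * G = G for the convolution product,
  whose unit sends t to \<epsilon>(t) 1; associativity of convolution is coassociativity together
  with associativity in \<open>P\<close>.\<close>

lemma convolution_inverse_unique:
  assumes "assoc_algebra R P"
    and E: "E \<in> linear_maps R T P" and D: "D \<in> linear_maps R T P" and G: "G \<in> linear_maps R T P"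
    and left: "\<And>t. t \<in> carrier T \<Longrightarrow> sweedler P (\<lambda>x y. E x \<otimes>\<^bsub>P\<^esub> D y) t = \<epsilon> t \<odot>\<^bsub>P\<^esub> \<one>\<^bsub>P\<^esub>"
    and right: "\<And>t. t \<in> carrier T \<Longrightarrow> sweedler P (\<lambda>x y. D x \<otimes>\<^bsub>P\<^esub> G y) t = \<epsilon> t \<odot>\<^bsub>P\<^esub> \<one>\<^bsub>P\<^esub>"
    and t: "t \<in> carrier T"
  shows "E t = G t"
proof -
  interpret P: assoc_algebra R P by fact
  note cl = linear_mapsD(1)[OF E] linear_mapsD(1)[OF D] linear_mapsD(1)[OF G]
  note lin = hopf_lin P.module_axioms P.linear_mult_left P.linear_mult_right P.M.m_closed
    E D G cl P.linear_smult counit_closed P.M.one_closed linear_maps_comp[OF E]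
    linear_maps_comp[OF D] linear_maps_comp[OF G]
  note lE = linear_mapsD[OF E] and lG = linear_mapsD[OF G]
  have "E t = E (sweedler T (\<lambda>x y. \<epsilon> y \<odot>\<^bsub>T\<^esub> x) t)"
    using counit_right t by simp
  also have "\<dots> = sweedler P (\<lambda>x y. E (\<epsilon> y \<odot>\<^bsub>T\<^esub> x)) t"
    by (rule sweedler_linear) (rule lin t linear_smult | assumption)+
  \<comment> \<open>The hypothesis \<open>right\<close>, read backwards, replaces the counit of the
    second leg by the convolution of \<open>D\<close> and \<open>G\<close>.\<close>
  also have "\<dots> = sweedler P (\<lambda>x w. E x \<otimes>\<^bsub>P\<^esub> sweedler P (\<lambda>y z. D y \<otimes>\<^bsub>P\<^esub> G z) w) t"
    by (rule tensor_lift_cong) (simp add: lE right counit_closed P.smult_mult_right)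
  also have "\<dots> = sweedler P (\<lambda>x w. sweedler P (\<lambda>y z. E x \<otimes>\<^bsub>P\<^esub> (D y \<otimes>\<^bsub>P\<^esub> G z)) w) t"
    by (rule tensor_lift_cong, rule sweedler_linear) (rule lin | assumption)+
  also have "\<dots> = sweedler P (\<lambda>w z. sweedler P (\<lambda>x y. E x \<otimes>\<^bsub>P\<^esub> (D y \<otimes>\<^bsub>P\<^esub> G z)) w) t"
    by (rule sweedler_coassoc[symmetric]) (rule lin t | assumption)+
  also have "\<dots> = sweedler P (\<lambda>w z. sweedler P (\<lambda>x y. (E x \<otimes>\<^bsub>P\<^esub> D y) \<otimes>\<^bsub>P\<^esub> G z) w) t"
    by (intro tensor_lift_cong) (simp add: cl P.M.m_assoc)
  also have "\<dots> = sweedler P (\<lambda>w z. sweedler P (\<lambda>x y. E x \<otimes>\<^bsub>P\<^esub> D y) w \<otimes>\<^bsub>P\<^esub> G z) t"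
    by (rule tensor_lift_cong, rule sweedler_linear[where g="\<lambda>u. u \<otimes>\<^bsub>P\<^esub> _", symmetric])
      (rule lin | assumption)+
  \<comment> \<open>Now \<open>left\<close> contracts \<open>E\<close> and \<open>D\<close> to a
    counit, which moves into the argument of \<open>G\<close>.\<close>
  also have "\<dots> = sweedler P (\<lambda>w z. G (\<epsilon> w \<odot>\<^bsub>T\<^esub> z)) t"
    by (rule tensor_lift_cong) (simp add: lG left counit_closed P.smult_mult_left)
  also have "\<dots> = G (sweedler T (\<lambda>w z. \<epsilon> w \<odot>\<^bsub>T\<^esub> z) t)"
    by (rule sweedler_linear[symmetric]) (rule lin t linear_smult | assumption)+
  also have "\<dots> = G t" using counit_left t by simp
  finally show ?thesis .
qed

text \<open>These aliases survive the addition of \<open>A\<close>, which shadows the unqualified names.\<close>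

lemmas T_module = module_axioms
lemmas T_one_closed = M.one_closed
lemmas T_m_closed = M.m_closed
lemmas T_linear_smult = linear_smult
lemmas T_smult_mult_left = smult_mult_left

lemma TT_assoc_algebra: "assoc_algebra R TT"
  by (rule tensor_algebra_assoc_algebra) (rule assoc_algebra_axioms)+

abbreviation "pt \<equiv> pure_tensor R T T"

lemma linear_pt_left:
  "\<lbrakk>f \<in> linear_maps R X T; y \<in> carrier T\<rbrakk> \<Longrightarrow> (\<lambda>x. pt (f x) y) \<in> linear_maps R X TT"
  unfolding linear_maps_tensor_algebra by (rule hopf_lin | assumption)+

lemma linear_pt_right:
  "\<lbrakk>f \<in> linear_maps R X T; y \<in> carrier T\<rbrakk> \<Longrightarrow> (\<lambda>x. pt y (f x)) \<in> linear_maps R X TT"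
  unfolding linear_maps_tensor_algebra by (rule hopf_lin | assumption)+

lemma linear_comult_TT: "f \<in> linear_maps R X T \<Longrightarrow> (\<lambda>x. \<Delta> (f x)) \<in> linear_maps R X TT"
  unfolding linear_maps_tensor_algebra by (rule hopf_lin | assumption)+

text \<open>Multiplicativity of \<Delta> makes the left side a left inverse of \<Delta> at once. For
  the reversed expression, the product with \<Delta> involves four legs of t, which cancel from the
  inside outwards.\<close>

lemma comult_antipode:
  assumes t: "t \<in> carrier T"
  shows "\<Delta> (S t) = sweedler TT (\<lambda>x y. pt (S y) (S x)) t"
proof (rule convolution_inverse_unique[where P=TT, OF TT_assoc_algebra _ _ _ _ _ t, where D=\<Delta>])
  interpret TT: assoc_algebra R TT by (rule TT_assoc_algebra)
  let ?G = "sweedler TT (\<lambda>x y. pt (S y) (S x))"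
  have pt_closed: "pt x y \<in> carrier TT" if "x \<in> carrier T" "y \<in> carrier T" for x y
    unfolding tensor_algebra_sel(1) by (rule hopf_lin that)+
  have comult_closed: "\<Delta> x \<in> carrier TT" if "x \<in> carrier T" for x
    unfolding tensor_algebra_sel(1) by (rule hopf_lin that)+
  note lin = hopf_lin TT.module_axioms TT.linear_mult_left TT.linear_mult_right TT.M.m_closed
    linear_pt_left linear_pt_right linear_comult_TT linear_smult pt_closed comult_closed counit_closed
  show lS: "(\<lambda>t. \<Delta> (S t)) \<in> linear_maps R T TT" and "\<Delta> \<in> linear_maps R T TT"
    and "?G \<in> linear_maps R T TT"
    by (rule lin | assumption)+
  show "sweedler TT (\<lambda>x y. \<Delta> (S x) \<otimes>\<^bsub>TT\<^esub> \<Delta> y) t = \<epsilon> t \<odot>\<^bsub>TT\<^esub> \<one>\<^bsub>TT\<^esub>"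
    if t: "t \<in> carrier T" for t
  proof -
    have "sweedler TT (\<lambda>x y. \<Delta> (S x) \<otimes>\<^bsub>TT\<^esub> \<Delta> y) t = sweedler TT (\<lambda>x y. \<Delta> (S x \<otimes>\<^bsub>T\<^esub> y)) t"
      by (rule tensor_lift_cong) (simp add: comult_mult antipode_closed)
    also have "\<dots> = \<Delta> (sweedler T (\<lambda>x y. S x \<otimes>\<^bsub>T\<^esub> y) t)"
      by (rule sweedler_linear[symmetric]) (rule lin t | assumption)+
    also have "\<dots> = \<epsilon> t \<odot>\<^bsub>TT\<^esub> \<one>\<^bsub>TT\<^esub>"
      using t linear_mapsD(3)[OF comult_linear] 
      by (simp add: antipode_left counit_closed comult_one tensor_algebra_sel(4))
    finally show ?thesis .
  qed
  show "sweedler TT (\<lambda>x y. \<Delta> x \<otimes>\<^bsub>TT\<^esub> ?G y) t = \<epsilon> t \<odot>\<^bsub>TT\<^esub> \<one>\<^bsub>TT\<^esub>"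
    if t: "t \<in> carrier T" for t
  proof -
    have G_closed: "?G y \<in> carrier TT" if "y \<in> carrier T" for y
      using that by - (rule lin | assumption)+
    \<comment> \<open>The arguments p, q, u, v stand for the four successive legs of t: the outer
      pair p, v meets in the first tensor factor and the inner pair q, u in the second.\<close>
    let ?F = "\<lambda>p q u v. pt (p \<otimes>\<^bsub>T\<^esub> S v) (q \<otimes>\<^bsub>T\<^esub> S u)"
    \<comment> \<open>Both factors are expanded into pure tensors, so that the product can be
      computed componentwise.\<close>
    have 1: "\<Delta> x \<otimes>\<^bsub>TT\<^esub> ?G y = sweedler TT (\<lambda>p q. sweedler TT (\<lambda>u v. ?F p q u v) y) x"
      if "x \<in> carrier T" "y \<in> carrier T" for x y
    proof -
      have "\<Delta> x \<otimes>\<^bsub>TT\<^esub> ?G y = sweedler TT (\<lambda>p q. pt p q) x \<otimes>\<^bsub>TT\<^esub> ?G y"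
        using that comult_sweedler
        by (simp add: tensor_lift_codomain_cong[OF linear_maps_tensor_algebra])
      also have "\<dots> = sweedler TT (\<lambda>p q. pt p q \<otimes>\<^bsub>TT\<^esub> ?G y) x"
        by (rule sweedler_linear[where g="\<lambda>u. u \<otimes>\<^bsub>TT\<^esub> _"]) (rule lin that | assumption)+
      also have "\<dots> = sweedler TT (\<lambda>p q. sweedler TT (\<lambda>u v. pt p q \<otimes>\<^bsub>TT\<^esub> pt (S v) (S u)) y) x"
        by (rule tensor_lift_cong, rule sweedler_linear) (rule lin that | assumption)+
      also have "\<dots> = sweedler TT (\<lambda>p q. sweedler TT (\<lambda>u v. ?F p q u v) y) x"
        by (intro tensor_lift_cong)
          (simp add: tensor_algebra_mult_pure[OF assoc_algebra_axioms assoc_algebra_axioms] antipode_closed)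
      finally show ?thesis .
    qed
    have "sweedler TT (\<lambda>x y. \<Delta> x \<otimes>\<^bsub>TT\<^esub> ?G y) t =
        sweedler TT (\<lambda>x y. sweedler TT (\<lambda>p q. sweedler TT (\<lambda>u v. ?F p q u v) y) x) t"
      by (rule tensor_lift_cong) (rule 1)
    \<comment> \<open>Two regroupings follow: the first splits off p, the second brings the adjacent
      legs q and u together.\<close>
    also have "\<dots> = sweedler TT (\<lambda>p r. sweedler TT (\<lambda>q y. sweedler TT (\<lambda>u v. ?F p q u v) y) r) t"
      by (rule sweedler_coassoc) (rule lin t | assumption)+
    also have "\<dots> = sweedler TT (\<lambda>p r. sweedler TT (\<lambda>w v. sweedler TT (\<lambda>q u. ?F p q u v) w) r) t"
      by (rule tensor_lift_cong, rule sweedler_coassoc[symmetric]) (rule lin | assumption)+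
    also have "\<dots> = sweedler TT (\<lambda>p r. sweedler TT (\<lambda>w v.
        pt (p \<otimes>\<^bsub>T\<^esub> S v) (sweedler T (\<lambda>q u. q \<otimes>\<^bsub>T\<^esub> S u) w)) r) t"
      by (intro tensor_lift_cong, rule sweedler_linear[symmetric]) (rule lin | assumption)+
    \<comment> \<open>The inner pair contracts to \<epsilon>(w) 1 in the second tensor factor. The
      scalar is carried over to v in the first factor, where the counit axiom absorbs it and leaves
      p S(r).\<close>
    also have "\<dots> = sweedler TT (\<lambda>p r. sweedler TT (\<lambda>w v. pt (p \<otimes>\<^bsub>T\<^esub> S (\<epsilon> w \<odot>\<^bsub>T\<^esub> v)) \<one>\<^bsub>T\<^esub>) r) t"
    proof (intro tensor_lift_cong)
      fix p r w v assume c: "p \<in> carrier T" "w \<in> carrier T" "v \<in> carrier T"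
      note right = linear_mapsD(3)[OF linear_pt_right[OF linear_maps_id]]
        and left = linear_mapsD(3)[OF linear_pt_left[OF linear_maps_id]]
      show "pt (p \<otimes>\<^bsub>T\<^esub> S v) (sweedler T (\<lambda>q u. q \<otimes>\<^bsub>T\<^esub> S u) w) =
          pt (p \<otimes>\<^bsub>T\<^esub> S (\<epsilon> w \<odot>\<^bsub>T\<^esub> v)) \<one>\<^bsub>T\<^esub>"
        using c by (simp add: antipode_right counit_closed antipode_closed left right
            linear_mapsD(3)[OF antipode_linear] smult_mult_right)
    qed
    also have "\<dots> = sweedler TT (\<lambda>p r. pt (p \<otimes>\<^bsub>T\<^esub> S (sweedler T (\<lambda>w v. \<epsilon> w \<odot>\<^bsub>T\<^esub> v) r)) \<one>\<^bsub>T\<^esub>) t"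
      by (rule tensor_lift_cong, rule sweedler_linear[symmetric, where g="\<lambda>x. pt (_ \<otimes>\<^bsub>T\<^esub> S x) \<one>\<^bsub>T\<^esub>"])
        (rule lin | assumption)+
    also have "\<dots> = sweedler TT (\<lambda>p r. pt (p \<otimes>\<^bsub>T\<^esub> S r) \<one>\<^bsub>T\<^esub>) t"
      by (rule tensor_lift_cong) (simp add: counit_left)
    also have "\<dots> = pt (sweedler T (\<lambda>p r. p \<otimes>\<^bsub>T\<^esub> S r) t) \<one>\<^bsub>T\<^esub>"
      by (rule sweedler_linear[symmetric, where g="\<lambda>x. pt x \<one>\<^bsub>T\<^esub>"]) (rule lin t | assumption)+
    also have "\<dots> = \<epsilon> t \<odot>\<^bsub>TT\<^esub> \<one>\<^bsub>TT\<^esub>"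
      using t linear_mapsD(3)[OF linear_pt_left[OF linear_maps_id]]
      by (simp add: antipode_right counit_closed tensor_algebra_sel(5))
    finally show ?thesis .
  qed
qed

text \<open>The linear map induced by \<open>f\<close> is applied to \<Delta>(s t) = \<Delta>(s)
  \<Delta>(t) after expanding both coproducts. This is what associativity in the smash product rests
  on.\<close>

lemma sweedler_mult:
  assumes P: "module R P" and f: "bilinear R T T P (\<lambda>x y. f x y)"
    and s: "s \<in> carrier T" and t: "t \<in> carrier T"
  shows "sweedler P (\<lambda>x y. f x y) (s \<otimes>\<^bsub>T\<^esub> t) =
    sweedler P (\<lambda>t\<^sub>1 t\<^sub>2. sweedler P (\<lambda>s\<^sub>1 s\<^sub>2. f (s\<^sub>1 \<otimes>\<^bsub>T\<^esub> t\<^sub>1) (s\<^sub>2 \<otimes>\<^bsub>T\<^esub> t\<^sub>2)) s) t"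
proof -
  interpret TT: assoc_algebra R TT by (rule TT_assoc_algebra)
  let ?\<phi> = "\<lambda>u. tensor_lift R T T P (\<lambda>x y. f x y) u"
  have pt_closed: "pt x y \<in> carrier TT" if "x \<in> carrier T" "y \<in> carrier T" for x y
    unfolding tensor_algebra_sel(1) by (rule hopf_lin that)+
  have comult_closed: "\<Delta> x \<in> carrier TT" if "x \<in> carrier T" for x
    unfolding tensor_algebra_sel(1) by (rule hopf_lin that)+
  note lin = hopf_lin TT.module_axioms TT.linear_mult_left TT.linear_mult_right TT.M.m_closed
    linear_pt_left linear_pt_right linear_comult_TT pt_closed comult_closed
  have \<phi>: "?\<phi> \<in> linear_maps R TT P"
  proof -
    have "?\<phi> \<in> linear_maps R (tensor R T T) P"
      by (rule hopf_lin P f | assumption)+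
    then show ?thesis by (simp add: linear_maps_def tensor_algebra_sel)
  qed
  have comult: "\<Delta> x = sweedler TT (\<lambda>p q. pt p q) x" if "x \<in> carrier T" for x
    using comult_sweedler[OF that]
    by (simp add: tensor_lift_codomain_cong[OF linear_maps_tensor_algebra])
  have "\<Delta> s \<otimes>\<^bsub>TT\<^esub> sweedler TT (\<lambda>t\<^sub>1 t\<^sub>2. pt t\<^sub>1 t\<^sub>2) t =
      sweedler TT (\<lambda>t\<^sub>1 t\<^sub>2. \<Delta> s \<otimes>\<^bsub>TT\<^esub> pt t\<^sub>1 t\<^sub>2) t"
    by (rule sweedler_linear) (rule lin s t | assumption)+
  also have "\<dots> = sweedler TT (\<lambda>t\<^sub>1 t\<^sub>2. sweedler TT (\<lambda>s\<^sub>1 s\<^sub>2. pt s\<^sub>1 s\<^sub>2) s \<otimes>\<^bsub>TT\<^esub> pt t\<^sub>1 t\<^sub>2) t"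
    by (simp only: comult[OF s, symmetric])
  also have "\<dots> = sweedler TT (\<lambda>t\<^sub>1 t\<^sub>2. sweedler TT (\<lambda>s\<^sub>1 s\<^sub>2. pt s\<^sub>1 s\<^sub>2 \<otimes>\<^bsub>TT\<^esub> pt t\<^sub>1 t\<^sub>2) s) t"
    by (rule tensor_lift_cong, rule sweedler_linear[where g="\<lambda>u. u \<otimes>\<^bsub>TT\<^esub> _"])
      (rule lin s | assumption)+
  also have "\<dots> = sweedler TT (\<lambda>t\<^sub>1 t\<^sub>2. sweedler TT (\<lambda>s\<^sub>1 s\<^sub>2. pt (s\<^sub>1 \<otimes>\<^bsub>T\<^esub> t\<^sub>1) (s\<^sub>2 \<otimes>\<^bsub>T\<^esub> t\<^sub>2)) s) t"
    by (intro tensor_lift_cong)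
      (simp add: tensor_algebra_mult_pure[OF assoc_algebra_axioms assoc_algebra_axioms])
  finally have "\<Delta> (s \<otimes>\<^bsub>T\<^esub> t) = \<dots>"
    using comult[OF t] comult_mult[OF s t] by simp
  then have "sweedler P (\<lambda>x y. f x y) (s \<otimes>\<^bsub>T\<^esub> t) = ?\<phi> \<dots>" by simp
  also have "\<dots> = sweedler P (\<lambda>t\<^sub>1 t\<^sub>2. ?\<phi> (sweedler TT (\<lambda>s\<^sub>1 s\<^sub>2. pt (s\<^sub>1 \<otimes>\<^bsub>T\<^esub> t\<^sub>1) (s\<^sub>2 \<otimes>\<^bsub>T\<^esub> t\<^sub>2)) s)) t"
    by (rule sweedler_linear) (rule lin P \<phi> s t | assumption)+
  also have "\<dots> = sweedler P (\<lambda>t\<^sub>1 t\<^sub>2. sweedler P (\<lambda>s\<^sub>1 s\<^sub>2. ?\<phi> (pt (s\<^sub>1 \<otimes>\<^bsub>T\<^esub> t\<^sub>1) (s\<^sub>2 \<otimes>\<^bsub>T\<^esub> t\<^sub>2))) s) t"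
    by (rule tensor_lift_cong, rule sweedler_linear) (rule lin P \<phi> s | assumption)+
  also have "\<dots> = sweedler P (\<lambda>t\<^sub>1 t\<^sub>2. sweedler P (\<lambda>s\<^sub>1 s\<^sub>2. f (s\<^sub>1 \<otimes>\<^bsub>T\<^esub> t\<^sub>1) (s\<^sub>2 \<otimes>\<^bsub>T\<^esub> t\<^sub>2)) s) t"
    by (intro tensor_lift_cong, rule tensor_lift_pure) (rule lin P f | assumption)+
  finally show ?thesis .
qed

text \<open>The form of \<open>comult_antipode\<close> used in computations: the legs of S(t) are
  the antipodes of the legs of t in the opposite order.\<close>

lemma sweedler_antipode:
  assumes P: "module R P" and f: "bilinear R T T P (\<lambda>x y. f x y)" and t: "t \<in> carrier T"
  shows "sweedler P (\<lambda>x y. f x y) (S t) = sweedler P (\<lambda>x y. f (S y) (S x)) t"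
proof -
  note lin = hopf_lin P f t
  have "sweedler P (\<lambda>x y. f x y) (S t) =
      tensor_lift R T T P (\<lambda>x y. f x y) (sweedler (tensor R T T) (\<lambda>x y. pt (S y) (S x)) t)"
    unfolding comult_antipode[OF t]
    by (simp add: tensor_lift_codomain_cong[OF linear_maps_tensor_algebra])
  also have "\<dots> = sweedler P (\<lambda>x y. tensor_lift R T T P (\<lambda>x y. f x y) (pt (S y) (S x))) t"
    by (rule sweedler_linear[where g="\<lambda>u. tensor_lift R T T P (\<lambda>x y. f x y) u"]) (rule lin | assumption)+
  also have "\<dots> = sweedler P (\<lambda>x y. f (S y) (S x)) t"
    by (rule tensor_lift_cong, rule tensor_lift_pure) (rule lin | assumption)+
  finally show ?thesis .
qed

end

section \<open>The smash product\<close>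

context yetter_drinfeld_module_algebra
begin

abbreviation "B \<equiv> smash R T \<Delta> A act"

abbreviation sharp :: "'a \<Rightarrow> 't \<Rightarrow> ('a \<times> 't \<Rightarrow> 'k) set" (infix \<open>\<sharp>\<close> 65)
  where "a \<sharp> t \<equiv> pure_tensor R A T a t"

abbreviation \<tau> where "\<tau> \<equiv> smash_tau R T \<Delta> S A act \<rho>"

lemma A_module: "module R A"
  by (rule assoc_algebra.axioms(1)[OF A.assoc_algebra_axioms])

lemma linear_act_left:
  "\<lbrakk>f \<in> linear_maps R X T; a \<in> carrier A\<rbrakk> \<Longrightarrow> (\<lambda>x. act (f x) a) \<in> linear_maps R X A"
  by (rule linear_maps_comp[OF act_linear_left])

lemma linear_act_right:
  "\<lbrakk>f \<in> linear_maps R X A; t \<in> carrier T\<rbrakk> \<Longrightarrow> (\<lambda>x. act t (f x)) \<in> linear_maps R X A"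
  by (rule linear_maps_comp[OF act_linear_right])

lemma act_closed: "\<lbrakk>t \<in> carrier T; a \<in> carrier A\<rbrakk> \<Longrightarrow> act t a \<in> carrier A"
  by (rule linear_mapsD(1)[OF act_linear_right])

text \<open>The construction of the tensor module never looks at the products, so passing to the
  opposite algebra leaves it unchanged.\<close>

lemma tensor_op_algebra: "tensor R A (op_algebra T) = tensor R A T"
  by (simp add: tensor_def tensor_kernel_def tensor_relations_def op_algebra_def)

lemma coaction_linear: "\<rho> \<in> linear_maps R A (tensor R A T)"
  using coaction_hom by (simp add: algebra_homs_def linear_maps_tensor_algebra tensor_op_algebra)

lemma linear_coaction: "f \<in> linear_maps R X A \<Longrightarrow> (\<lambda>x. \<rho> (f x)) \<in> linear_maps R X (tensor R A T)"
  by (rule linear_maps_comp[OF coaction_linear])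

lemma coaction_closed: "a \<in> carrier A \<Longrightarrow> \<rho> a \<in> carrier (tensor R A T)"
  by (rule linear_mapsD(1)[OF coaction_linear])

lemma coaction_one: "\<rho> \<one>\<^bsub>A\<^esub> = \<one>\<^bsub>A\<^esub> \<sharp> \<one>\<^bsub>T\<^esub>"
proof -
  have "\<rho> \<one>\<^bsub>A\<^esub> = pure_tensor R A (op_algebra T) \<one>\<^bsub>A\<^esub> \<one>\<^bsub>op_algebra T\<^esub>"
    using coaction_hom by (simp add: algebra_homs_def ring_hom_def tensor_algebra_sel)
  also have "\<dots> = \<one>\<^bsub>A\<^esub> \<sharp> \<one>\<^bsub>T\<^esub>"
    by (simp add: pure_tensor_def tensor_kernel_def tensor_relations_def op_algebra_def)
  finally show ?thesis .
qed

lemma smash_sel: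
  "carrier B = carrier (tensor R A T)" "add B = add (tensor R A T)"
  "zero B = zero (tensor R A T)" "smult B = smult (tensor R A T)" "\<one>\<^bsub>B\<^esub> = \<one>\<^bsub>A\<^esub> \<sharp> \<one>\<^bsub>T\<^esub>"
  by (simp_all add: smash_def)

lemma linear_maps_smash:
  "linear_maps R X B = linear_maps R X (tensor R A T)"
  "linear_maps R B X = linear_maps R (tensor R A T) X"
  by (simp_all add: linear_maps_def smash_sel)

lemma smash_module: "module R B"
  by (rule module_cong[OF module_tensor[OF A_module T_module]]) (simp_all add: smash_sel)

lemma sharp_closed: "\<lbrakk>a \<in> carrier A; t \<in> carrier T\<rbrakk> \<Longrightarrow> a \<sharp> t \<in> carrier B"
  unfolding smash_sel(1) by (rule pure_tensor_closed[OF A_module T_module])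

lemma linear_sharp_left:
  "\<lbrakk>f \<in> linear_maps R X A; t \<in> carrier T\<rbrakk> \<Longrightarrow> (\<lambda>x. f x \<sharp> t) \<in> linear_maps R X B"
  unfolding linear_maps_smash by (rule linear_pure_tensor_left[OF A_module T_module])

lemma linear_sharp_right:
  "\<lbrakk>f \<in> linear_maps R X T; a \<in> carrier A\<rbrakk> \<Longrightarrow> (\<lambda>x. a \<sharp> f x) \<in> linear_maps R X B"
  unfolding linear_maps_smash by (rule linear_pure_tensor_right[OF A_module T_module])

lemmas smash_lin = hopf_lin A_module smash_module A.linear_mult_left A.linear_mult_right
  A.M.m_closed A.M.one_closed linear_act_left linear_act_right act_closed linear_coaction
  coaction_closed sharp_closed linear_sharp_left linear_sharp_right

text \<open>The defining formula with all intermediate sums valued in \<open>B\<close> itself, so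
  that the linearity rules for \<open>B\<close> apply at every level.\<close>

lemma smash_mult:
  "u \<otimes>\<^bsub>B\<^esub> v = tensor_lift R A T B (\<lambda>a s. tensor_lift R A T B (\<lambda>b t.
     sweedler B (\<lambda>s\<^sub>1 s\<^sub>2. (a \<otimes>\<^bsub>A\<^esub> act s\<^sub>1 b) \<sharp> (s\<^sub>2 \<otimes>\<^bsub>T\<^esub> t)) s) v) u"
  by (simp add: tensor_lift_codomain_cong[OF linear_maps_smash(1)]) (simp add: smash_def)

lemma linear_smash_mult_left:
  assumes "f \<in> linear_maps R X B" "v \<in> carrier B"
  shows "(\<lambda>x. f x \<otimes>\<^bsub>B\<^esub> v) \<in> linear_maps R X B"
proof (rule linear_maps_comp[OF _ assms(1)])
  show "(\<lambda>u. u \<otimes>\<^bsub>B\<^esub> v) \<in> linear_maps R B B"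
    using assms(2) unfolding smash_mult linear_maps_smash(2) smash_sel(1)
    by - (rule smash_lin | assumption)+
qed

lemma linear_smash_mult_right:
  assumes "f \<in> linear_maps R X B" "u \<in> carrier B"
  shows "(\<lambda>x. u \<otimes>\<^bsub>B\<^esub> f x) \<in> linear_maps R X B"
proof (rule linear_maps_comp[OF _ assms(1)])
  show "(\<lambda>v. u \<otimes>\<^bsub>B\<^esub> v) \<in> linear_maps R B B"
    using assms(2) unfolding smash_mult linear_maps_smash(2) smash_sel(1)
    by - (rule smash_lin | assumption)+
qed

lemma smash_mult_closed: "\<lbrakk>u \<in> carrier B; v \<in> carrier B\<rbrakk> \<Longrightarrow> u \<otimes>\<^bsub>B\<^esub> v \<in> carrier B"
  by (rule linear_mapsD(1)[OF linear_smash_mult_right[OF linear_maps_id]])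

lemmas smash_lin' = smash_lin linear_smash_mult_left linear_smash_mult_right smash_mult_closed

lemma smash_mult_sharp:
  assumes "a \<in> carrier A" "s \<in> carrier T" "b \<in> carrier A" "t \<in> carrier T"
  shows "(a \<sharp> s) \<otimes>\<^bsub>B\<^esub> (b \<sharp> t) =
    sweedler B (\<lambda>s\<^sub>1 s\<^sub>2. (a \<otimes>\<^bsub>A\<^esub> act s\<^sub>1 b) \<sharp> (s\<^sub>2 \<otimes>\<^bsub>T\<^esub> t)) s"
proof -
  have *: "b \<sharp> t \<in> carrier (tensor R A T)"
    using sharp_closed assms unfolding smash_sel(1) by blast
  have "(a \<sharp> s) \<otimes>\<^bsub>B\<^esub> (b \<sharp> t) = tensor_lift R A T B (\<lambda>b t.
     sweedler B (\<lambda>s\<^sub>1 s\<^sub>2. (a \<otimes>\<^bsub>A\<^esub> act s\<^sub>1 b) \<sharp> (s\<^sub>2 \<otimes>\<^bsub>T\<^esub> t)) s) (b \<sharp> t)"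
    unfolding smash_mult
    by (rule tensor_lift_pure) (rule smash_lin assms * | assumption)+
  also have "\<dots> = sweedler B (\<lambda>s\<^sub>1 s\<^sub>2. (a \<otimes>\<^bsub>A\<^esub> act s\<^sub>1 b) \<sharp> (s\<^sub>2 \<otimes>\<^bsub>T\<^esub> t)) s"
    by (rule tensor_lift_pure) (rule smash_lin assms | assumption)+
  finally show ?thesis .
qed

lemma smash_mult_A:
  assumes "a \<in> carrier A" "b \<in> carrier A"
  shows "(a \<sharp> \<one>\<^bsub>T\<^esub>) \<otimes>\<^bsub>B\<^esub> (b \<sharp> \<one>\<^bsub>T\<^esub>) = (a \<otimes>\<^bsub>A\<^esub> b) \<sharp> \<one>\<^bsub>T\<^esub>"
proof -
  have "(a \<sharp> \<one>\<^bsub>T\<^esub>) \<otimes>\<^bsub>B\<^esub> (b \<sharp> \<one>\<^bsub>T\<^esub>) =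
      tensor_lift R T T B (\<lambda>s\<^sub>1 s\<^sub>2. (a \<otimes>\<^bsub>A\<^esub> act s\<^sub>1 b) \<sharp> (s\<^sub>2 \<otimes>\<^bsub>T\<^esub> \<one>\<^bsub>T\<^esub>)) (pt \<one>\<^bsub>T\<^esub> \<one>\<^bsub>T\<^esub>)"
    using smash_mult_sharp assms T_one_closed by (simp add: comult_one tensor_algebra_sel(5))
  also have "\<dots> = (a \<otimes>\<^bsub>A\<^esub> act \<one>\<^bsub>T\<^esub> b) \<sharp> (\<one>\<^bsub>T\<^esub> \<otimes>\<^bsub>T\<^esub> \<one>\<^bsub>T\<^esub>)"
    by (rule tensor_lift_pure) (rule smash_lin assms | assumption)+
  also have "\<dots> = (a \<otimes>\<^bsub>A\<^esub> b) \<sharp> \<one>\<^bsub>T\<^esub>" using assms by (simp add: act_one)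
  finally show ?thesis .
qed

text \<open>Acting on the unit of A produces the scalar \<epsilon>(s1). It is moved across
  \<open>\<sharp>\<close> to the T leg, where the counit axiom absorbs it.\<close>

lemma smash_mult_sharp_T:
  assumes "a \<in> carrier A" "s \<in> carrier T" "t \<in> carrier T"
  shows "(a \<sharp> s) \<otimes>\<^bsub>B\<^esub> (\<one>\<^bsub>A\<^esub> \<sharp> t) = a \<sharp> (s \<otimes>\<^bsub>T\<^esub> t)"
proof -
  have "(a \<sharp> s) \<otimes>\<^bsub>B\<^esub> (\<one>\<^bsub>A\<^esub> \<sharp> t) =
      sweedler B (\<lambda>s\<^sub>1 s\<^sub>2. (a \<otimes>\<^bsub>A\<^esub> act s\<^sub>1 \<one>\<^bsub>A\<^esub>) \<sharp> (s\<^sub>2 \<otimes>\<^bsub>T\<^esub> t)) s"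
    by (rule smash_mult_sharp) (rule smash_lin assms)+
  also have "\<dots> = sweedler B (\<lambda>s\<^sub>1 s\<^sub>2. a \<sharp> ((\<epsilon> s\<^sub>1 \<odot>\<^bsub>T\<^esub> s\<^sub>2) \<otimes>\<^bsub>T\<^esub> t)) s"
  proof (rule tensor_lift_cong)
    fix x y assume c: "x \<in> carrier T" "y \<in> carrier T"
    have yt: "y \<otimes>\<^bsub>T\<^esub> t \<in> carrier T" using c assms by (simp add: T_m_closed)
    have "(a \<otimes>\<^bsub>A\<^esub> act x \<one>\<^bsub>A\<^esub>) \<sharp> (y \<otimes>\<^bsub>T\<^esub> t) = (\<epsilon> x \<odot>\<^bsub>A\<^esub> a) \<sharp> (y \<otimes>\<^bsub>T\<^esub> t)"
      using c assms by (simp add: act_unit A.smult_mult_right counit_closed)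
    also have "\<dots> = \<epsilon> x \<odot>\<^bsub>B\<^esub> (a \<sharp> (y \<otimes>\<^bsub>T\<^esub> t))"
      using linear_mapsD(3)[OF linear_sharp_left[OF linear_maps_id yt]] c assms counit_closed by simp
    also have "\<dots> = a \<sharp> (\<epsilon> x \<odot>\<^bsub>T\<^esub> (y \<otimes>\<^bsub>T\<^esub> t))"
      using linear_mapsD(3)[OF linear_sharp_right[OF linear_maps_id assms(1)]] c yt counit_closed by simp
    also have "\<dots> = a \<sharp> ((\<epsilon> x \<odot>\<^bsub>T\<^esub> y) \<otimes>\<^bsub>T\<^esub> t)"
      using c assms by (simp add: T_smult_mult_left counit_closed)
    finally show "(a \<otimes>\<^bsub>A\<^esub> act x \<one>\<^bsub>A\<^esub>) \<sharp> (y \<otimes>\<^bsub>T\<^esub> t) = a \<sharp> ((\<epsilon> x \<odot>\<^bsub>T\<^esub> y) \<otimes>\<^bsub>T\<^esub> t)" .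
  qed
  also have "\<dots> = a \<sharp> (sweedler T (\<lambda>s\<^sub>1 s\<^sub>2. \<epsilon> s\<^sub>1 \<odot>\<^bsub>T\<^esub> s\<^sub>2) s \<otimes>\<^bsub>T\<^esub> t)"
    by (rule sweedler_linear[symmetric, where g="\<lambda>x. a \<sharp> (x \<otimes>\<^bsub>T\<^esub> t)"])
      (rule smash_lin T_linear_smult counit_closed assms | assumption)+
  finally show ?thesis using counit_left assms by simp
qed

text \<open>The exchange rule: an element of T passes to the right of A at the cost of acting with
  its first leg.\<close>

lemma smash_mult_T_A:
  assumes "t \<in> carrier T" "a \<in> carrier A"
  shows "(\<one>\<^bsub>A\<^esub> \<sharp> t) \<otimes>\<^bsub>B\<^esub> (a \<sharp> \<one>\<^bsub>T\<^esub>) = sweedler B (\<lambda>t\<^sub>1 t\<^sub>2. act t\<^sub>1 a \<sharp> t\<^sub>2) t"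
proof -
  have "(\<one>\<^bsub>A\<^esub> \<sharp> t) \<otimes>\<^bsub>B\<^esub> (a \<sharp> \<one>\<^bsub>T\<^esub>) =
      sweedler B (\<lambda>t\<^sub>1 t\<^sub>2. (\<one>\<^bsub>A\<^esub> \<otimes>\<^bsub>A\<^esub> act t\<^sub>1 a) \<sharp> (t\<^sub>2 \<otimes>\<^bsub>T\<^esub> \<one>\<^bsub>T\<^esub>)) t"
    by (rule smash_mult_sharp) (rule smash_lin assms)+
  also have "\<dots> = sweedler B (\<lambda>t\<^sub>1 t\<^sub>2. act t\<^sub>1 a \<sharp> t\<^sub>2) t"
    by (rule tensor_lift_cong) (simp add: act_closed assms)
  finally show ?thesis .
qed

text \<open>The instance of associativity called for by the coaction generators. By linearity u may
  be b \<sharp> t; then t1 acting after s1 is t1 s1 acting, and \<open>sweedler_mult\<close>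
  recognises the legs of t s.\<close>

lemma smash_mult_assoc_T_A:
  assumes u: "u \<in> carrier B" and s: "s \<in> carrier T" and c: "c \<in> carrier A"
  shows "u \<otimes>\<^bsub>B\<^esub> ((\<one>\<^bsub>A\<^esub> \<sharp> s) \<otimes>\<^bsub>B\<^esub> (c \<sharp> \<one>\<^bsub>T\<^esub>)) = (u \<otimes>\<^bsub>B\<^esub> (\<one>\<^bsub>A\<^esub> \<sharp> s)) \<otimes>\<^bsub>B\<^esub> (c \<sharp> \<one>\<^bsub>T\<^esub>)"
    (is "u \<otimes>\<^bsub>B\<^esub> (?s \<otimes>\<^bsub>B\<^esub> ?c) = _")
proof -
  interpret tensor_product R A T by (rule tensor_product.intro[OF A_module T_module])
  have l: "(\<lambda>u. u \<otimes>\<^bsub>B\<^esub> (?s \<otimes>\<^bsub>B\<^esub> ?c)) \<in> linear_maps R B B"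
    and r: "(\<lambda>u. (u \<otimes>\<^bsub>B\<^esub> ?s) \<otimes>\<^bsub>B\<^esub> ?c) \<in> linear_maps R B B"
    by (rule smash_lin' s c)+
  show ?thesis
  proof (rule linear_maps_tensor_eqI[OF l[unfolded linear_maps_smash(2)] r[unfolded linear_maps_smash(2)]
        _ u[unfolded smash_sel(1)]])
    fix b t assume b: "b \<in> carrier A" and t: "t \<in> carrier T"
    note lin = smash_lin' b t s c
    have "(b \<sharp> t) \<otimes>\<^bsub>B\<^esub> (?s \<otimes>\<^bsub>B\<^esub> ?c) = (b \<sharp> t) \<otimes>\<^bsub>B\<^esub> sweedler B (\<lambda>s\<^sub>1 s\<^sub>2. act s\<^sub>1 c \<sharp> s\<^sub>2) s"
      using smash_mult_T_A[OF s c] by simp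
    also have "\<dots> = sweedler B (\<lambda>s\<^sub>1 s\<^sub>2. (b \<sharp> t) \<otimes>\<^bsub>B\<^esub> (act s\<^sub>1 c \<sharp> s\<^sub>2)) s"
      by (rule sweedler_linear) (rule lin | assumption)+
    also have "\<dots> = sweedler B (\<lambda>s\<^sub>1 s\<^sub>2. sweedler B (\<lambda>t\<^sub>1 t\<^sub>2.
        (b \<otimes>\<^bsub>A\<^esub> act t\<^sub>1 (act s\<^sub>1 c)) \<sharp> (t\<^sub>2 \<otimes>\<^bsub>T\<^esub> s\<^sub>2)) t) s"
      by (rule tensor_lift_cong, rule smash_mult_sharp) (rule lin | assumption)+
    also have "\<dots> = sweedler B (\<lambda>s\<^sub>1 s\<^sub>2. sweedler B (\<lambda>t\<^sub>1 t\<^sub>2.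
        (b \<otimes>\<^bsub>A\<^esub> act (t\<^sub>1 \<otimes>\<^bsub>T\<^esub> s\<^sub>1) c) \<sharp> (t\<^sub>2 \<otimes>\<^bsub>T\<^esub> s\<^sub>2)) t) s"
      by (intro tensor_lift_cong) (simp add: act_mult c)
    also have "\<dots> = sweedler B (\<lambda>q\<^sub>1 q\<^sub>2. (b \<otimes>\<^bsub>A\<^esub> act q\<^sub>1 c) \<sharp> q\<^sub>2) (t \<otimes>\<^bsub>T\<^esub> s)"
      by (rule sweedler_mult[symmetric]) (rule lin | assumption)+
    \<comment> \<open>The unit of T is inserted to give the summand the shape of a product with c
      \<sharp> 1.\<close>
    also have "\<dots> = sweedler B (\<lambda>q\<^sub>1 q\<^sub>2. (b \<otimes>\<^bsub>A\<^esub> act q\<^sub>1 c) \<sharp> (q\<^sub>2 \<otimes>\<^bsub>T\<^esub> \<one>\<^bsub>T\<^esub>)) (t \<otimes>\<^bsub>T\<^esub> s)"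
      by (rule tensor_lift_cong) simp
    also have "\<dots> = (b \<sharp> (t \<otimes>\<^bsub>T\<^esub> s)) \<otimes>\<^bsub>B\<^esub> ?c"
      by (rule smash_mult_sharp[symmetric]) (rule lin | assumption)+
    finally show "(b \<sharp> t) \<otimes>\<^bsub>B\<^esub> (?s \<otimes>\<^bsub>B\<^esub> ?c) = (b \<sharp> t) \<otimes>\<^bsub>B\<^esub> ?s \<otimes>\<^bsub>B\<^esub> ?c"
      using smash_mult_sharp_T[OF b t s] by simp
  qed
qed

text \<open>The exchange rule turns the summand into the first leg of s acting on a, with the second
  leg times the antipode of the third in T; these last two legs cancel.\<close>

lemma adjoint_action:
  assumes s: "s \<in> carrier T" and a: "a \<in> carrier A"
  shows "sweedler B (\<lambda>s\<^sub>1 s\<^sub>2. (\<one>\<^bsub>A\<^esub> \<sharp> s\<^sub>1) \<otimes>\<^bsub>B\<^esub> (a \<sharp> \<one>\<^bsub>T\<^esub>) \<otimes>\<^bsub>B\<^esub> (\<one>\<^bsub>A\<^esub> \<sharp> S s\<^sub>2)) s = act s a \<sharp> \<one>\<^bsub>T\<^esub>"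
proof -
  note lin = smash_lin' T_linear_smult counit_closed s a
  have 1: "(\<one>\<^bsub>A\<^esub> \<sharp> s\<^sub>1) \<otimes>\<^bsub>B\<^esub> (a \<sharp> \<one>\<^bsub>T\<^esub>) \<otimes>\<^bsub>B\<^esub> (\<one>\<^bsub>A\<^esub> \<sharp> S s\<^sub>2) =
      sweedler B (\<lambda>p q. act p a \<sharp> (q \<otimes>\<^bsub>T\<^esub> S s\<^sub>2)) s\<^sub>1"
    if c: "s\<^sub>1 \<in> carrier T" "s\<^sub>2 \<in> carrier T" for s\<^sub>1 s\<^sub>2
  proof -
    have "(\<one>\<^bsub>A\<^esub> \<sharp> s\<^sub>1) \<otimes>\<^bsub>B\<^esub> (a \<sharp> \<one>\<^bsub>T\<^esub>) \<otimes>\<^bsub>B\<^esub> (\<one>\<^bsub>A\<^esub> \<sharp> S s\<^sub>2) =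
        sweedler B (\<lambda>p q. act p a \<sharp> q) s\<^sub>1 \<otimes>\<^bsub>B\<^esub> (\<one>\<^bsub>A\<^esub> \<sharp> S s\<^sub>2)"
      using smash_mult_T_A c a by simp
    also have "\<dots> = sweedler B (\<lambda>p q. (act p a \<sharp> q) \<otimes>\<^bsub>B\<^esub> (\<one>\<^bsub>A\<^esub> \<sharp> S s\<^sub>2)) s\<^sub>1"
      by (rule sweedler_linear[where g="\<lambda>u. u \<otimes>\<^bsub>B\<^esub> _"]) (rule lin c | assumption)+
    also have "\<dots> = sweedler B (\<lambda>p q. act p a \<sharp> (q \<otimes>\<^bsub>T\<^esub> S s\<^sub>2)) s\<^sub>1"
      by (rule tensor_lift_cong) (simp add: smash_mult_sharp_T act_closed antipode_closed a c)
    finally show ?thesis .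
  qed
  have "sweedler B (\<lambda>s\<^sub>1 s\<^sub>2. (\<one>\<^bsub>A\<^esub> \<sharp> s\<^sub>1) \<otimes>\<^bsub>B\<^esub> (a \<sharp> \<one>\<^bsub>T\<^esub>) \<otimes>\<^bsub>B\<^esub> (\<one>\<^bsub>A\<^esub> \<sharp> S s\<^sub>2)) s =
      sweedler B (\<lambda>w z. sweedler B (\<lambda>p q. act p a \<sharp> (q \<otimes>\<^bsub>T\<^esub> S z)) w) s"
    by (rule tensor_lift_cong) (rule 1)
  \<comment> \<open>Regrouping separates the acting leg p from the pair q, z that the antipode axiom
    contracts.\<close>
  also have "\<dots> = sweedler B (\<lambda>p w. sweedler B (\<lambda>q z. act p a \<sharp> (q \<otimes>\<^bsub>T\<^esub> S z)) w) s"
    by (rule sweedler_coassoc) (rule lin | assumption)+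
  also have "\<dots> = sweedler B (\<lambda>p w. act p a \<sharp> sweedler T (\<lambda>q z. q \<otimes>\<^bsub>T\<^esub> S z) w) s"
    by (rule tensor_lift_cong, rule sweedler_linear[symmetric]) (rule lin | assumption)+
  \<comment> \<open>The scalar \<epsilon>(w) left by the contraction is attached to p, so that the
    counit axiom restores s.\<close>
  also have "\<dots> = sweedler B (\<lambda>p w. act (\<epsilon> w \<odot>\<^bsub>T\<^esub> p) a \<sharp> \<one>\<^bsub>T\<^esub>) s"
  proof (rule tensor_lift_cong)
    fix p w assume c: "p \<in> carrier T" "w \<in> carrier T"
    have pa: "act p a \<in> carrier A" using c a by (simp add: act_closed)
    show "act p a \<sharp> sweedler T (\<lambda>q z. q \<otimes>\<^bsub>T\<^esub> S z) w = act (\<epsilon> w \<odot>\<^bsub>T\<^esub> p) a \<sharp> \<one>\<^bsub>T\<^esub>"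
      using c pa linear_mapsD(3)[OF linear_sharp_right[OF linear_maps_id pa]]
        linear_mapsD(3)[OF linear_sharp_left[OF linear_maps_id T_one_closed]]
        linear_mapsD(3)[OF act_linear_left[OF a]]
      by (simp add: antipode_right counit_closed T_one_closed)
  qed
  also have "\<dots> = act (sweedler T (\<lambda>p w. \<epsilon> w \<odot>\<^bsub>T\<^esub> p) s) a \<sharp> \<one>\<^bsub>T\<^esub>"
    by (rule sweedler_linear[symmetric, where g="\<lambda>x. act x a \<sharp> \<one>\<^bsub>T\<^esub>"]) (rule lin | assumption)+
  finally show ?thesis using counit_right s by simp
qed

text \<open>This is \<open>adjoint_action\<close> at S(t): since S reverses the coproduct, the legs
  of S(t) are S(t2) and S(t1), and the second receives another antipode.\<close>

lemma adjoint_action_antipode: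
  assumes t: "t \<in> carrier T" and a: "a \<in> carrier A"
  shows "sweedler B (\<lambda>t\<^sub>1 t\<^sub>2. (\<one>\<^bsub>A\<^esub> \<sharp> S t\<^sub>2) \<otimes>\<^bsub>B\<^esub> (a \<sharp> \<one>\<^bsub>T\<^esub>) \<otimes>\<^bsub>B\<^esub> (\<one>\<^bsub>A\<^esub> \<sharp> S (S t\<^sub>1))) t =
    act (S t) a \<sharp> \<one>\<^bsub>T\<^esub>"
  unfolding adjoint_action[OF antipode_closed[OF t] a, symmetric]
  by (rule sweedler_antipode[symmetric]) (rule smash_lin' t a | assumption)+

section \<open>The map \<open>\<tau>\<close> and its values on A and on T\<close>

lemma tau_bilinear:
  "bilinear R A T B (\<lambda>a t. tensor_lift R A T B
     (\<lambda>a\<^sub>0 a\<^sub>1. (\<one>\<^bsub>A\<^esub> \<sharp> (S t \<otimes>\<^bsub>T\<^esub> S (S a\<^sub>1))) \<otimes>\<^bsub>B\<^esub> (a\<^sub>0 \<sharp> \<one>\<^bsub>T\<^esub>)) (\<rho> a))"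
  by (rule smash_lin' | assumption)+

lemma tau_linear: "\<tau> \<in> linear_maps R B B"
  unfolding linear_maps_smash(2) smash_tau_def smash_left_def smash_right_def
  by (rule linear_tensor_lift[OF A_module T_module smash_module tau_bilinear linear_maps_id])

lemma tau_sharp:
  assumes "a \<in> carrier A" "t \<in> carrier T"
  shows "\<tau> (a \<sharp> t) = tensor_lift R A T B
     (\<lambda>a\<^sub>0 a\<^sub>1. (\<one>\<^bsub>A\<^esub> \<sharp> (S t \<otimes>\<^bsub>T\<^esub> S (S a\<^sub>1))) \<otimes>\<^bsub>B\<^esub> (a\<^sub>0 \<sharp> \<one>\<^bsub>T\<^esub>)) (\<rho> a)"
  unfolding smash_tau_def smash_left_def smash_right_def
  by (rule tensor_lift_pure[OF A_module T_module smash_module tau_bilinear assms])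

lemma tau_A:
  assumes "a \<in> carrier A"
  shows "\<tau> (a \<sharp> \<one>\<^bsub>T\<^esub>) = tensor_lift R A T B
     (\<lambda>a\<^sub>0 a\<^sub>1. (\<one>\<^bsub>A\<^esub> \<sharp> S (S a\<^sub>1)) \<otimes>\<^bsub>B\<^esub> (a\<^sub>0 \<sharp> \<one>\<^bsub>T\<^esub>)) (\<rho> a)"
  unfolding tau_sharp[OF assms T_one_closed]
  by (rule tensor_lift_cong) (simp add: antipode_one antipode_closed)

text \<open>The coaction sends 1 to 1 \<otimes> 1, so the factors coming from the coaction are
  S(S(1)) = 1 and 1.\<close>

lemma tau_T:
  assumes "t \<in> carrier T"
  shows "\<tau> (\<one>\<^bsub>A\<^esub> \<sharp> t) = \<one>\<^bsub>A\<^esub> \<sharp> S t"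
proof -
  have "\<tau> (\<one>\<^bsub>A\<^esub> \<sharp> t) = (\<one>\<^bsub>A\<^esub> \<sharp> (S t \<otimes>\<^bsub>T\<^esub> S (S \<one>\<^bsub>T\<^esub>))) \<otimes>\<^bsub>B\<^esub> (\<one>\<^bsub>A\<^esub> \<sharp> \<one>\<^bsub>T\<^esub>)"
    unfolding tau_sharp[OF A.M.one_closed assms] coaction_one
    by (rule tensor_lift_pure) (rule smash_lin' assms | assumption)+
  also have "\<dots> = \<one>\<^bsub>A\<^esub> \<sharp> S t"
    using assms by (simp add: antipode_one antipode_closed smash_mult_sharp_T T_one_closed A.M.one_closed)
  finally show ?thesis .
qed

text \<open>Coacting again on the 0-component amounts to applying the coproduct to the
  1-component.\<close>

lemma coaction_coassoc_lift:
  assumes "module R P" "a \<in> carrier A"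
    and "\<And>x. x \<in> carrier A \<Longrightarrow> bilinear R T T P (\<lambda>y z. f x y z)"
    and "\<And>y z. \<lbrakk>y \<in> carrier T; z \<in> carrier T\<rbrakk> \<Longrightarrow> (\<lambda>x. f x y z) \<in> linear_maps R A P"
  shows "tensor_lift R A T P (\<lambda>w z. tensor_lift R A T P (\<lambda>x y. f x y z) (\<rho> w)) (\<rho> a) =
    tensor_lift R A T P (\<lambda>x w. sweedler P (\<lambda>y z. f x y z) w) (\<rho> a)"
  by (rule trilinear_reassociate)
    (rule assms coaction_coassoc[OF assms(2)] smash_lin comult_linear coaction_linear | assumption)+

text \<open>The membership claim with explicit preimages: x a, the sum of (S(x1) acting on a) x0,
  and f acting on a, for the three kinds of generators.\<close>

lemma twisted_sandwich_mem:
  assumes I: "finite I" and K: "K \<in> I \<rightarrow> carrier B" and L: "L \<in> I \<rightarrow> carrier B"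
    and gen: "(\<Oplus>\<^bsub>tensor R B B\<^esub>r\<in>I. pure_tensor R B B (K r) (L r))
      \<in> distinguished_generators R T \<Delta> S A act \<rho>"
    and a: "a \<in> carrier A"
  shows "(\<Oplus>\<^bsub>B\<^esub>r\<in>I. K r \<otimes>\<^bsub>B\<^esub> (a \<sharp> \<one>\<^bsub>T\<^esub>) \<otimes>\<^bsub>B\<^esub> \<tau> (L r)) \<in> (\<lambda>a. a \<sharp> \<one>\<^bsub>T\<^esub>) ` carrier A"
proof -
  note lin = smash_lin' a linear_maps_comp[OF tau_linear] linear_mapsD(1)[OF tau_linear]
  define \<Phi> where "\<Phi> = tensor_lift R B B B (\<lambda>u v. u \<otimes>\<^bsub>B\<^esub> (a \<sharp> \<one>\<^bsub>T\<^esub>) \<otimes>\<^bsub>B\<^esub> \<tau> v)"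
  have bil: "bilinear R B B B (\<lambda>u v. u \<otimes>\<^bsub>B\<^esub> (a \<sharp> \<one>\<^bsub>T\<^esub>) \<otimes>\<^bsub>B\<^esub> \<tau> v)"
    by (rule lin | assumption)+
  have \<Phi>: "\<Phi> \<in> linear_maps R (tensor R B B) B"
    unfolding \<Phi>_def by (rule lin bil | assumption)+
  have \<Phi>_pure: "\<Phi> (pure_tensor R B B u v) = u \<otimes>\<^bsub>B\<^esub> (a \<sharp> \<one>\<^bsub>T\<^esub>) \<otimes>\<^bsub>B\<^esub> \<tau> v"
    if "u \<in> carrier B" "v \<in> carrier B" for u v
    unfolding \<Phi>_def by (rule tensor_lift_pure[OF smash_module smash_module smash_module bil that])
  interpret B: module R B by (rule smash_module)
  \<comment> \<open>The sum depends only on the tensor represented by \<open>K\<close> and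
    \<open>L\<close>, so the chosen presentation may be replaced by the one displayed for each
    generator.\<close>
  have sum: "(\<Oplus>\<^bsub>B\<^esub>r\<in>I. K r \<otimes>\<^bsub>B\<^esub> (a \<sharp> \<one>\<^bsub>T\<^esub>) \<otimes>\<^bsub>B\<^esub> \<tau> (L r)) =
      \<Phi> (\<Oplus>\<^bsub>tensor R B B\<^esub>r\<in>I. pure_tensor R B B (K r) (L r))"
  proof -
    have K': "K r \<in> carrier B" and L': "L r \<in> carrier B" if "r \<in> I" for r
      using K L that by auto
    have "\<Phi> (\<Oplus>\<^bsub>tensor R B B\<^esub>r\<in>I. pure_tensor R B B (K r) (L r)) =
        (\<Oplus>\<^bsub>B\<^esub>r\<in>I. \<Phi> (pure_tensor R B B (K r) (L r)))"
      by (rule linear_maps_finsum[OF module_tensor smash_module \<Phi> I])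
        (use K' L' pure_tensor_closed[OF smash_module smash_module] smash_module in auto)
    also have "\<dots> = (\<Oplus>\<^bsub>B\<^esub>r\<in>I. K r \<otimes>\<^bsub>B\<^esub> (a \<sharp> \<one>\<^bsub>T\<^esub>) \<otimes>\<^bsub>B\<^esub> \<tau> (L r))"
      by (rule B.M.finsum_cong'[OF refl])
        (use K' L' \<Phi>_pure smash_mult_closed sharp_closed a linear_mapsD(1)[OF tau_linear] in auto)
    finally show ?thesis by simp
  qed
  from gen consider
    (A) x where "x \<in> carrier A"
      "(\<Oplus>\<^bsub>tensor R B B\<^esub>r\<in>I. pure_tensor R B B (K r) (L r)) = pure_tensor R B B (x \<sharp> \<one>\<^bsub>T\<^esub>) \<one>\<^bsub>B\<^esub>"
  | (coaction) x where "x \<in> carrier A"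
      "(\<Oplus>\<^bsub>tensor R B B\<^esub>r\<in>I. pure_tensor R B B (K r) (L r)) =
        tensor_lift R A T (tensor R B B)
          (\<lambda>x\<^sub>0 x\<^sub>1. pure_tensor R B B (\<one>\<^bsub>A\<^esub> \<sharp> S x\<^sub>1) (x\<^sub>0 \<sharp> \<one>\<^bsub>T\<^esub>)) (\<rho> x)"
  | (comult) f where "f \<in> carrier T"
      "(\<Oplus>\<^bsub>tensor R B B\<^esub>r\<in>I. pure_tensor R B B (K r) (L r)) =
        sweedler (tensor R B B) (\<lambda>f\<^sub>1 f\<^sub>2. pure_tensor R B B (\<one>\<^bsub>A\<^esub> \<sharp> f\<^sub>1) (\<one>\<^bsub>A\<^esub> \<sharp> f\<^sub>2)) f"
    unfolding distinguished_generators_def Let_def smash_left_def smash_right_def by blast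
  then show ?thesis
  proof cases
    case (A x)
    \<comment> \<open>The unit of \<open>B\<close> lies in T, so \<open>\<tau>\<close> sends it to
      S(1) = 1 and only x a remains.\<close>
    have "\<Phi> (pure_tensor R B B (x \<sharp> \<one>\<^bsub>T\<^esub>) \<one>\<^bsub>B\<^esub>) = (x \<otimes>\<^bsub>A\<^esub> a) \<sharp> \<one>\<^bsub>T\<^esub>"
      using A(1) a tau_T[OF T_one_closed]
      by (simp add: \<Phi>_pure smash_sel(5) sharp_closed smash_mult_A antipode_one T_one_closed A.M.one_closed A.M.m_closed)
    then show ?thesis using sum A a A.M.m_closed by auto
  next
    case (coaction x)
    note x = coaction(1)
    \<comment> \<open>\<open>?W\<close> collects the three factors that will form an adjoint action;
      the remaining element of A is kept outside on the right, which is where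
      \<open>smash_mult_assoc_T_A\<close> enters.\<close>
    let ?W = "\<lambda>x\<^sub>1 y\<^sub>1. (\<one>\<^bsub>A\<^esub> \<sharp> S x\<^sub>1) \<otimes>\<^bsub>B\<^esub> (a \<sharp> \<one>\<^bsub>T\<^esub>) \<otimes>\<^bsub>B\<^esub> (\<one>\<^bsub>A\<^esub> \<sharp> S (S y\<^sub>1))"
    have "\<Phi> (tensor_lift R A T (tensor R B B)
          (\<lambda>x\<^sub>0 x\<^sub>1. pure_tensor R B B (\<one>\<^bsub>A\<^esub> \<sharp> S x\<^sub>1) (x\<^sub>0 \<sharp> \<one>\<^bsub>T\<^esub>)) (\<rho> x)) =
        tensor_lift R A T B (\<lambda>x\<^sub>0 x\<^sub>1. \<Phi> (pure_tensor R B B (\<one>\<^bsub>A\<^esub> \<sharp> S x\<^sub>1) (x\<^sub>0 \<sharp> \<one>\<^bsub>T\<^esub>))) (\<rho> x)"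
      by (rule linear_map_tensor_lift) (rule lin x \<Phi> | assumption)+
    also have "\<dots> = tensor_lift R A T B (\<lambda>x\<^sub>0 x\<^sub>1. tensor_lift R A T B
        (\<lambda>y\<^sub>0 y\<^sub>1. ?W x\<^sub>1 y\<^sub>1 \<otimes>\<^bsub>B\<^esub> (y\<^sub>0 \<sharp> \<one>\<^bsub>T\<^esub>)) (\<rho> x\<^sub>0)) (\<rho> x)"
    proof (rule tensor_lift_cong)
      fix x\<^sub>0 x\<^sub>1 assume c: "x\<^sub>0 \<in> carrier A" "x\<^sub>1 \<in> carrier T"
      let ?u = "(\<one>\<^bsub>A\<^esub> \<sharp> S x\<^sub>1) \<otimes>\<^bsub>B\<^esub> (a \<sharp> \<one>\<^bsub>T\<^esub>)"
      have u: "?u \<in> carrier B" by (rule lin c)+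
      have "\<Phi> (pure_tensor R B B (\<one>\<^bsub>A\<^esub> \<sharp> S x\<^sub>1) (x\<^sub>0 \<sharp> \<one>\<^bsub>T\<^esub>)) = ?u \<otimes>\<^bsub>B\<^esub> \<tau> (x\<^sub>0 \<sharp> \<one>\<^bsub>T\<^esub>)"
        by (rule \<Phi>_pure) (rule lin c)+
      also have "\<dots> = tensor_lift R A T B
          (\<lambda>y\<^sub>0 y\<^sub>1. ?u \<otimes>\<^bsub>B\<^esub> ((\<one>\<^bsub>A\<^esub> \<sharp> S (S y\<^sub>1)) \<otimes>\<^bsub>B\<^esub> (y\<^sub>0 \<sharp> \<one>\<^bsub>T\<^esub>))) (\<rho> x\<^sub>0)"
        unfolding tau_A[OF c(1)] by (rule linear_map_tensor_lift) (rule lin u c | assumption)+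
      also have "\<dots> = tensor_lift R A T B (\<lambda>y\<^sub>0 y\<^sub>1. ?W x\<^sub>1 y\<^sub>1 \<otimes>\<^bsub>B\<^esub> (y\<^sub>0 \<sharp> \<one>\<^bsub>T\<^esub>)) (\<rho> x\<^sub>0)"
        by (rule tensor_lift_cong) (simp add: smash_mult_assoc_T_A u antipode_closed)
      finally show "\<Phi> (pure_tensor R B B (\<one>\<^bsub>A\<^esub> \<sharp> S x\<^sub>1) (x\<^sub>0 \<sharp> \<one>\<^bsub>T\<^esub>)) = \<dots>" .
    qed
    \<comment> \<open>After reassociation \<open>w\<close> is the 1-component of x, with
      \<open>y\<^sub>1\<close> its first and \<open>x\<^sub>1\<close> its second leg. This is
      exactly the reversed order that \<open>adjoint_action_antipode\<close> expects.\<close>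
    also have "\<dots> = tensor_lift R A T B (\<lambda>y\<^sub>0 w.
        sweedler B (\<lambda>y\<^sub>1 x\<^sub>1. ?W x\<^sub>1 y\<^sub>1 \<otimes>\<^bsub>B\<^esub> (y\<^sub>0 \<sharp> \<one>\<^bsub>T\<^esub>)) w) (\<rho> x)"
      by (rule coaction_coassoc_lift) (rule lin x | assumption)+
    also have "\<dots> = tensor_lift R A T B (\<lambda>y\<^sub>0 w.
        sweedler B (\<lambda>y\<^sub>1 x\<^sub>1. ?W x\<^sub>1 y\<^sub>1) w \<otimes>\<^bsub>B\<^esub> (y\<^sub>0 \<sharp> \<one>\<^bsub>T\<^esub>)) (\<rho> x)"
      by (rule tensor_lift_cong, rule sweedler_linear[symmetric, where g="\<lambda>u. u \<otimes>\<^bsub>B\<^esub> _"])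
        (rule lin | assumption)+
    also have "\<dots> = tensor_lift R A T B (\<lambda>y\<^sub>0 w. (act (S w) a \<otimes>\<^bsub>A\<^esub> y\<^sub>0) \<sharp> \<one>\<^bsub>T\<^esub>) (\<rho> x)"
      by (rule tensor_lift_cong)
        (simp add: adjoint_action_antipode a smash_mult_A act_closed antipode_closed)
    \<comment> \<open>The embedding of A is linear and leaves the sum, which exhibits the preimage
      in A.\<close>
    also have "\<dots> = tensor_lift R A T A (\<lambda>y\<^sub>0 w. act (S w) a \<otimes>\<^bsub>A\<^esub> y\<^sub>0) (\<rho> x) \<sharp> \<one>\<^bsub>T\<^esub>"
      by (rule linear_map_tensor_lift[symmetric, where g="\<lambda>x. x \<sharp> \<one>\<^bsub>T\<^esub>"]) (rule lin x | assumption)+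
    also have "\<dots> \<in> (\<lambda>a. a \<sharp> \<one>\<^bsub>T\<^esub>) ` carrier A"
      by (rule imageI) (rule lin x | assumption)+
    finally show ?thesis using sum coaction(2) by simp
  next
    case (comult f)
    have "\<Phi> (sweedler (tensor R B B) (\<lambda>f\<^sub>1 f\<^sub>2. pure_tensor R B B (\<one>\<^bsub>A\<^esub> \<sharp> f\<^sub>1) (\<one>\<^bsub>A\<^esub> \<sharp> f\<^sub>2)) f) =
        sweedler B (\<lambda>f\<^sub>1 f\<^sub>2. \<Phi> (pure_tensor R B B (\<one>\<^bsub>A\<^esub> \<sharp> f\<^sub>1) (\<one>\<^bsub>A\<^esub> \<sharp> f\<^sub>2))) f"
      by (rule sweedler_linear) (rule lin comult \<Phi> | assumption)+
    \<comment> \<open>On T the map \<open>\<tau>\<close> is just S, so the expression is already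
      that of \<open>adjoint_action\<close>.\<close>
    also have "\<dots> = sweedler B (\<lambda>f\<^sub>1 f\<^sub>2. (\<one>\<^bsub>A\<^esub> \<sharp> f\<^sub>1) \<otimes>\<^bsub>B\<^esub> (a \<sharp> \<one>\<^bsub>T\<^esub>) \<otimes>\<^bsub>B\<^esub> (\<one>\<^bsub>A\<^esub> \<sharp> S f\<^sub>2)) f"
      by (rule tensor_lift_cong) (simp add: \<Phi>_pure sharp_closed tau_T A.M.one_closed)
    also have "\<dots> = act f a \<sharp> \<one>\<^bsub>T\<^esub>" by (rule adjoint_action[OF comult(1) a])
    finally show ?thesis using sum comult act_closed a by auto
  qed
qed

end

theorem lemma4p10:
  fixes R :: "('k, 'c) ring_scheme"
    and T :: "('k, 't, 'd) module_scheme"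
    and A :: "('k, 'a, 'e) module_scheme"
    and \<Delta> :: "'t \<Rightarrow> ('t \<times> 't \<Rightarrow> 'k) set" and \<epsilon> :: "'t \<Rightarrow> 'k" and S :: "'t \<Rightarrow> 't"
    and act :: "'t \<Rightarrow> 'a \<Rightarrow> 'a" and \<rho> :: "'a \<Rightarrow> ('a \<times> 't \<Rightarrow> 'k) set"
    and I :: "'i set" and K L :: "'i \<Rightarrow> ('a \<times> 't \<Rightarrow> 'k) set"
  defines "B \<equiv> smash R T \<Delta> A act"
  assumes "braided_commutative_yd_algebra R T \<Delta> \<epsilon> S A act \<rho>"
    and "bij_betw S (carrier T) (carrier T)"
    and "finite I" and "K \<in> I \<rightarrow> carrier B" and "L \<in> I \<rightarrow> carrier B"
    and "(\<Oplus>\<^bsub>tensor R B B\<^esub>r\<in>I. pure_tensor R B B (K r) (L r))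
           \<in> distinguished_generators R T \<Delta> S A act \<rho>"
    and "a \<in> carrier A"
  shows "(\<Oplus>\<^bsub>B\<^esub>r\<in>I. K r \<otimes>\<^bsub>B\<^esub> smash_left R T A a \<otimes>\<^bsub>B\<^esub> smash_tau R T \<Delta> S A act \<rho> (L r))
           \<in> smash_left R T A ` carrier A"
proof -
  interpret braided_commutative_yd_algebra R T \<Delta> \<epsilon> S A act \<rho> by fact
  \<comment> \<open>What is left is notation: \<open>smash_left\<close> is the embedding of A as a
    \<sharp> 1.\<close>
  show ?thesis
    using twisted_sandwich_mem[of I K L a] assms(4-) by (simp add: B_def smash_left_def[abs_def])
qed

end
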